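(* Let $F$ be a sufficiently saturated model of a dimensional theory expanding the theory of fields, with dimension $\delta$. Let $Y\subseteq F$ be a type-definable subset (over a small set of parameters) satisfying $0<\delta(YY-Y)=\delta(Y)<\infty$. Then $\frac{Y-Y}{Y-Y}$ is a definable field (a definable subfield of $F$), and $\delta\left(\frac{Y-Y}{Y-Y}\right)=\delta(Y)$.
   Context: Dimension. Let $T$ be a complete first-order theory and $M\models T$. "Definable" means definable with parameters; $\operatorname{Def}(M)$ is the collection of sets definable in $M$ (subsets of finite Cartesian powers of $M$) with parameters from $M$. A (continuous, real-valued) dimension is a function $\delta:\operatorname{Def}(M)\to\mathbb{R}_{\ge 0}\cup\{+\infty\}$ such that for all definable $X,Y$: (1) $\delta(X\cup Y)=\max\{\delta(X),\delta(Y)\}$; (2) $\delta(X\times Y)=\delta(X)+\delta(Y)$ for $X,Y$ nonempty; (3) $\delta(X)=0$ if $X$ is finite; (4) $\delta(X\cap Y)\le\min\{\delta(X),\delta(Y)\}$; (5) for every definable surjection $f:X\to Y$ between nonempty sets, $\delta(Y)+\inf_{y\in Y}\delta(f^{-1}(y))\le\delta(X)\le\delta(Y)+\sup_{y\in Y}\delta(f^{-1}(y))$; and (continuity) for every formula $\phi(\bar x,\bar y)$ and reals $s<t$ there is a $\emptyset$-definable set $D$ with $\{a:\delta(\phi(\bar x,a))\le s\}\subseteq D\subseteq\{b:\delta(\phi(\bar x,b))<t\}$. $T$ is a dimensional theory if some model has such a $\delta$; by continuity $\delta(\phi(\bar x,a))$ depends only on $\operatorname{tp}(a/\emptyset)$,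 so $\delta$ transfers uniquely to all models of $T$ and is called the dimension of $T$. Partial types. A partial type is a consistent collection of formulas, possibly with parameters; a type-definable set is the set of realizations of a partial type over a small parameter set, in the saturated model. For a partial type $\Gamma$, $\delta(\Gamma)=\inf\{\delta(\phi):\Gamma\models\phi\}$. Set operations. For subsets $X,Y$ of a field, $X\pm Y=\{x\pm y\}$, $XY=\{xy\}$, with $x\in X,y\in Y$ (so $YY-Y=\{yy'-y'':y,y',y''\in Y\}$), and $\frac{X}{Y}=\{x/y:x\in X,\ y\in Y\setminus\{0\}\}$. *)

theory Defs
  imports "HOL-Library.Extended_Nonnegative_Real"
begin

unbundle cardinal_syntax

section \<open>First-order logic with parameters\<close>

text \<open>A symbol paired with an arity is what counts as a function or relation symbol of the language.
  The universe of a structure is the whole type \<open>'a\<close>; interpretations are only relevant on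
  argument lists of the right length.\<close>

record ('f, 'r) language =
  Funs :: "('f \<times> nat) set"
  Rels :: "('r \<times> nat) set"

record ('a, 'f, 'r) fo_structure =
  fun_int :: "'f \<Rightarrow> 'a list \<Rightarrow> 'a"
  rel_int :: "'r \<Rightarrow> 'a list \<Rightarrow> bool"

text \<open>Elements of the structure may occur in formulas as parameters; \<open>tm_params\<close> and
  \<open>fm_params\<close> are the sets of parameters that occur.\<close>

datatype (tm_params: 'a, 'f) tm =
  Var nat | Par 'a | App 'f "('a, 'f) tm list"

datatype (fm_params: 'a, 'f, 'r) fm =
  Eql "('a, 'f) tm" "('a, 'f) tm"
| Rel 'r "('a, 'f) tm list"
| Neg "('a, 'f, 'r) fm"
| Conj "('a, 'f, 'r) fm" "('a, 'f, 'r) fm"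
| Exi nat "('a, 'f, 'r) fm"

fun wf_tm :: "('f, 'r) language \<Rightarrow> ('a, 'f) tm \<Rightarrow> bool" where
  "wf_tm L (Var v) = True"
| "wf_tm L (Par a) = True"
| "wf_tm L (App f ts) = ((f, length ts) \<in> Funs L \<and> (\<forall>t\<in>set ts. wf_tm L t))"

fun wf_fm :: "('f, 'r) language \<Rightarrow> ('a, 'f, 'r) fm \<Rightarrow> bool" where
  "wf_fm L (Eql s t) = (wf_tm L s \<and> wf_tm L t)"
| "wf_fm L (Rel r ts) = ((r, length ts) \<in> Rels L \<and> (\<forall>t\<in>set ts. wf_tm L t))"
| "wf_fm L (Neg \<phi>) = wf_fm L \<phi>"
| "wf_fm L (Conj \<phi> \<psi>) = (wf_fm L \<phi> \<and> wf_fm L \<psi>)"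
| "wf_fm L (Exi v \<phi>) = wf_fm L \<phi>"

fun tm_vars :: "('a, 'f) tm \<Rightarrow> nat set" where
  "tm_vars (Var v) = {v}"
| "tm_vars (Par a) = {}"
| "tm_vars (App f ts) = (\<Union>t\<in>set ts. tm_vars t)"

fun fm_free :: "('a, 'f, 'r) fm \<Rightarrow> nat set" where
  "fm_free (Eql s t) = tm_vars s \<union> tm_vars t"
| "fm_free (Rel r ts) = (\<Union>t\<in>set ts. tm_vars t)"
| "fm_free (Neg \<phi>) = fm_free \<phi>"
| "fm_free (Conj \<phi> \<psi>) = fm_free \<phi> \<union> fm_free \<psi>"
| "fm_free (Exi v \<phi>) = fm_free \<phi> - {v}"

fun tm_val :: "('a, 'f, 'r) fo_structure \<Rightarrow> (nat \<Rightarrow> 'a) \<Rightarrow> ('a, 'f) tm \<Rightarrow> 'a" where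
  "tm_val M e (Var v) = e v"
| "tm_val M e (Par a) = a"
| "tm_val M e (App f ts) = fun_int M f (map (tm_val M e) ts)"

fun sat :: "('a, 'f, 'r) fo_structure \<Rightarrow> (nat \<Rightarrow> 'a) \<Rightarrow> ('a, 'f, 'r) fm \<Rightarrow> bool" where
  "sat M e (Eql s t) = (tm_val M e s = tm_val M e t)"
| "sat M e (Rel r ts) = rel_int M r (map (tm_val M e) ts)"
| "sat M e (Neg \<phi>) = (\<not> sat M e \<phi>)"
| "sat M e (Conj \<phi> \<psi>) = (sat M e \<phi> \<and> sat M e \<psi>)"
| "sat M e (Exi v \<phi>) = (\<exists>a. sat M (e(v := a)) \<phi>)"

text \<open>Formulas over the parameter set \<open>A\<close> in the free variables numbered \<open>0, \<dots>, n - 1\<close>.\<close>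

definition formulas :: "('f, 'r) language \<Rightarrow> 'a set \<Rightarrow> nat \<Rightarrow> ('a, 'f, 'r) fm set" where
  "formulas L A n = {\<phi>. wf_fm L \<phi> \<and> fm_params \<phi> \<subseteq> A \<and> fm_free \<phi> \<subseteq> {..<n}}"

text \<open>The \<open>n\<close>-th Cartesian power of the universe is the set of lists of length \<open>n\<close>.\<close>

definition solutions :: "('a, 'f, 'r) fo_structure \<Rightarrow> nat \<Rightarrow> ('a, 'f, 'r) fm \<Rightarrow> 'a list set" where
  "solutions M n \<phi> = {xs. length xs = n \<and> sat M ((!) xs) \<phi>}"

definition definable_over ::
  "('f, 'r) language \<Rightarrow> ('a, 'f, 'r) fo_structure \<Rightarrow> 'a set \<Rightarrow> nat \<Rightarrow> 'a list set \<Rightarrow> bool" where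
  "definable_over L M A n X \<longleftrightarrow> (\<exists>\<phi>\<in>formulas L A n. X = solutions M n \<phi>)"

definition definable ::
  "('f, 'r) language \<Rightarrow> ('a, 'f, 'r) fo_structure \<Rightarrow> nat \<Rightarrow> 'a list set \<Rightarrow> bool" where
  "definable L M n X \<longleftrightarrow> definable_over L M UNIV n X"

definition list_product :: "'a list set \<Rightarrow> 'a list set \<Rightarrow> 'a list set" where
  "list_product X Y = {xs @ ys | xs ys. xs \<in> X \<and> ys \<in> Y}"

text \<open>A definable surjection from \<open>X \<subseteq> M\<^sup>m\<close> onto \<open>Y \<subseteq> M\<^sup>n\<close>: the graph is definable.
  Values of \<open>f\<close> outside \<open>X\<close> are irrelevant.\<close>

definition definable_surjection ::
  "('f, 'r) language \<Rightarrow> ('a, 'f, 'r) fo_structure \<Rightarrow> nat \<Rightarrow> nat \<Rightarrow>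
    'a list set \<Rightarrow> 'a list set \<Rightarrow> ('a list \<Rightarrow> 'a list) \<Rightarrow> bool" where
  "definable_surjection L M m n X Y f \<longleftrightarrow>
     definable L M m X \<and> definable L M n Y \<and> f ` X = Y \<and>
     definable L M (m + n) {xs @ f xs | xs. xs \<in> X}"


section \<open>Types and saturation\<close>

text \<open>Consistency (with the elementary diagram of \<open>M\<close>) is finite satisfiability in \<open>M\<close>.\<close>

definition partial_type ::
  "('f, 'r) language \<Rightarrow> ('a, 'f, 'r) fo_structure \<Rightarrow> 'a set \<Rightarrow> nat \<Rightarrow>
    ('a, 'f, 'r) fm set \<Rightarrow> bool" where
  "partial_type L M A n \<Gamma> \<longleftrightarrow>
     \<Gamma> \<subseteq> formulas L A n \<and>
     (\<forall>\<Delta>. \<Delta> \<subseteq> \<Gamma> \<and> finite \<Delta> \<longrightarrow> (\<exists>xs. length xs = n \<and> (\<forall>\<phi>\<in>\<Delta>. sat M ((!) xs) \<phi>)))"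

definition realizations ::
  "('a, 'f, 'r) fo_structure \<Rightarrow> nat \<Rightarrow> ('a, 'f, 'r) fm set \<Rightarrow> 'a list set" where
  "realizations M n \<Gamma> = {xs. length xs = n \<and> (\<forall>\<phi>\<in>\<Gamma>. sat M ((!) xs) \<phi>)}"

definition type_definable ::
  "('f, 'r) language \<Rightarrow> ('a, 'f, 'r) fo_structure \<Rightarrow> 'a set \<Rightarrow> nat \<Rightarrow> 'a list set \<Rightarrow> bool" where
  "type_definable L M A n Y \<longleftrightarrow> (\<exists>\<Gamma>. partial_type L M A n \<Gamma> \<and> Y = realizations M n \<Gamma>)"

definition saturated ::
  "'k rel \<Rightarrow> ('f, 'r) language \<Rightarrow> ('a, 'f, 'r) fo_structure \<Rightarrow> bool" where
  "saturated \<kappa> L M \<longleftrightarrow>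
     (\<forall>A n \<Gamma>. |A| <o \<kappa> \<and> partial_type L M A n \<Gamma> \<longrightarrow> realizations M n \<Gamma> \<noteq> {})"

text \<open>Sufficient saturation is \<open>\<kappa>\<close>-saturation for an uncountable cardinal \<open>\<kappa>\<close> larger than the
  language; a parameter set is small when its cardinality is less than \<open>\<kappa>\<close>.\<close>

definition sufficiently_saturated ::
  "'k rel \<Rightarrow> ('f, 'r) language \<Rightarrow> ('a, 'f, 'r) fo_structure \<Rightarrow> bool" where
  "sufficiently_saturated \<kappa> L M \<longleftrightarrow>
     Card_order \<kappa> \<and> natLeq <o \<kappa> \<and> |Funs L| <o \<kappa> \<and> |Rels L| <o \<kappa> \<and> saturated \<kappa> L M"


section \<open>Dimension\<close>

text \<open>Only the values of \<open>\<delta>\<close> on definable sets matter. In the continuity axiom the first \<open>m\<close>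
  variables of \<open>\<phi>\<close> are the object variables and the last \<open>n\<close> are the parameter variables; for
  negative \<open>s\<close> the axiom would be trivial, with the empty set as \<open>D\<close>. The complete theory that a
  structure \<open>M\<close> with a dimension makes dimensional is the theory of \<open>M\<close>.\<close>

locale continuous_dimension =
  fixes L :: "('f, 'r) language"
    and M :: "('a, 'f, 'r) fo_structure"
    and \<delta> :: "'a list set \<Rightarrow> ennreal"
  assumes dim_union:
      "\<And>n X Y. definable L M n X \<Longrightarrow> definable L M n Y \<Longrightarrow> \<delta> (X \<union> Y) = max (\<delta> X) (\<delta> Y)"
    and dim_product:
      "\<And>m n X Y. definable L M m X \<Longrightarrow> definable L M n Y \<Longrightarrow> X \<noteq> {} \<Longrightarrow> Y \<noteq> {} \<Longrightarrow>
         \<delta> (list_product X Y) = \<delta> X + \<delta> Y"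
    and dim_finite:
      "\<And>n X. definable L M n X \<Longrightarrow> finite X \<Longrightarrow> \<delta> X = 0"
    and dim_inter:
      "\<And>n X Y. definable L M n X \<Longrightarrow> definable L M n Y \<Longrightarrow> \<delta> (X \<inter> Y) \<le> min (\<delta> X) (\<delta> Y)"
    and dim_fibre_lower:
      "\<And>m n X Y f. definable_surjection L M m n X Y f \<Longrightarrow> X \<noteq> {} \<Longrightarrow> Y \<noteq> {} \<Longrightarrow>
         \<delta> Y + (INF y\<in>Y. \<delta> {x \<in> X. f x = y}) \<le> \<delta> X"
    and dim_fibre_upper:
      "\<And>m n X Y f. definable_surjection L M m n X Y f \<Longrightarrow> X \<noteq> {} \<Longrightarrow> Y \<noteq> {} \<Longrightarrow>
         \<delta> X \<le> \<delta> Y + (SUP y\<in>Y. \<delta> {x \<in> X. f x = y})"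
    and dim_continuity:
      "\<And>m n \<phi> (s::real) (t::real). \<phi> \<in> formulas L {} (m + n) \<Longrightarrow> 0 \<le> s \<Longrightarrow> s < t \<Longrightarrow>
         \<exists>D. definable_over L M {} n D \<and>
           {a. length a = n \<and>
               \<delta> {x. length x = m \<and> x @ a \<in> solutions M (m + n) \<phi>} \<le> ennreal s} \<subseteq> D \<and>
           D \<subseteq> {b. length b = n \<and>
               \<delta> {x. length x = m \<and> x @ b \<in> solutions M (m + n) \<phi>} < ennreal t}"

text \<open>The dimension of a type-definable set \<open>Y = \<Gamma>(M)\<close> is the infimum of \<open>\<delta>(\<phi>)\<close> over the formulas
  \<open>\<phi>\<close> with \<open>\<Gamma> \<Turnstile> \<phi>\<close>. When \<open>\<Gamma>\<close> is over a small set and \<open>M\<close> is sufficiently saturated,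
  \<open>\<Gamma> \<Turnstile> \<phi>\<close> means that every realization of \<open>\<Gamma>\<close> in \<open>M\<close> satisfies \<open>\<phi>\<close>, so the infimum depends
  on \<open>Y\<close> only.\<close>

definition type_dim ::
  "('f, 'r) language \<Rightarrow> ('a, 'f, 'r) fo_structure \<Rightarrow> ('a list set \<Rightarrow> ennreal) \<Rightarrow> nat \<Rightarrow>
    'a list set \<Rightarrow> ennreal" where
  "type_dim L M \<delta> n Y = (INF \<phi>\<in>{\<phi> \<in> formulas L UNIV n. Y \<subseteq> solutions M n \<phi>}. \<delta> (solutions M n \<phi>))"


section \<open>Fields\<close>

definition expands_field ::
  "('f, 'r) language \<Rightarrow> ('a::field, 'f, 'r) fo_structure \<Rightarrow> bool" where
  "expands_field L M \<longleftrightarrow>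
     (\<exists>c. (c, 0) \<in> Funs L \<and> fun_int M c [] = 0) \<and>
     (\<exists>c. (c, 0) \<in> Funs L \<and> fun_int M c [] = 1) \<and>
     (\<exists>f. (f, 2) \<in> Funs L \<and> (\<forall>x y. fun_int M f [x, y] = x + y)) \<and>
     (\<exists>f. (f, 1) \<in> Funs L \<and> (\<forall>x. fun_int M f [x] = - x)) \<and>
     (\<exists>f. (f, 2) \<in> Funs L \<and> (\<forall>x y. fun_int M f [x, y] = x * y))"

definition is_subfield :: "'a::field set \<Rightarrow> bool" where
  "is_subfield K \<longleftrightarrow>
     0 \<in> K \<and> 1 \<in> K \<and>
     (\<forall>x\<in>K. \<forall>y\<in>K. x + y \<in> K) \<and> (\<forall>x\<in>K. - x \<in> K) \<and>
     (\<forall>x\<in>K. \<forall>y\<in>K. x * y \<in> K) \<and> (\<forall>x\<in>K. x \<noteq> 0 \<longrightarrow> inverse x \<in> K)"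

definition set_diff :: "'a::field set \<Rightarrow> 'a set \<Rightarrow> 'a set" where
  "set_diff X Y = {x - y | x y. x \<in> X \<and> y \<in> Y}"

definition set_mult :: "'a::field set \<Rightarrow> 'a set \<Rightarrow> 'a set" where
  "set_mult X Y = {x * y | x y. x \<in> X \<and> y \<in> Y}"

definition set_quot :: "'a::field set \<Rightarrow> 'a set \<Rightarrow> 'a set" where
  "set_quot X Y = {x / y | x y. x \<in> X \<and> y \<in> Y - {0}}"

text \<open>A subset of the universe seen as a subset of its first Cartesian power.\<close>

definition singles :: "'a set \<Rightarrow> 'a list set" where
  "singles X = (\<lambda>x. [x]) ` X"

end

theory Submission
  imports Defs
begin

text \<open>Let \<open>d = \<delta>(Y)\<close> and let \<open>\<epsilon>\<close> be small. By compactness some definable \<open>B \<supseteq> Y\<close> has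
  \<open>\<delta>(BB - B) \<le> d + \<epsilon>\<close>, so all dilates \<open>yB\<close>, \<open>yy'B\<close> with nonzero \<open>y, y' \<in> Y\<close> are close to \<open>B\<close> in
  the Ruzsa distance. By continuity there is a definable set \<open>S\<close> of popular differences of \<open>B\<close>,
  those \<open>x\<close> with \<open>\<delta>(B \<inter> (B + x))\<close> at least about \<open>d\<close>. Counting representations, sums of boundedly
  many dilates of \<open>S\<close> still have dimension about \<open>d\<close>; hence so does \<open>S + aS\<close> when \<open>a\<close> is a quotient of
  short sums of products of elements of \<open>Y\<close>. If \<open>a\<close> is not in \<open>K = (Y - Y)/(Y - Y)\<close>, then compactness
  yields a subset \<open>C \<subseteq> S\<close> of dimension about \<open>d\<close> on which \<open>(c, c') \<mapsto> c + ac'\<close> is injective, so that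
  \<open>S + aS\<close> has dimension about \<open>2d\<close>. This gap makes \<open>K\<close> definable by continuity and closed under the
  field operations. It contains an affine image of \<open>Y\<close>, and each nonzero element of \<open>K\<close> is a quotient
  of elements of \<open>S + S\<close> in a \<open>d\<close>-dimensional family of ways, so \<open>\<delta>(K) = d\<close>.\<close>

section \<open>Definable predicates on environments\<close>

lemma tm_val_cong:
  "(\<And>v. v \<in> tm_vars t \<Longrightarrow> e v = e' v) \<Longrightarrow> tm_val M e t = tm_val M e' t"
proof (induction t)
  case (App f ts)
  then have "map (tm_val M e) ts = map (tm_val M e') ts"
    by (auto intro!: map_cong)
  then show ?case by (simp del: map_eq_conv)
qed auto

lemma sat_cong:
  "(\<And>v. v \<in> fm_free \<phi> \<Longrightarrow> e v = e' v) \<Longrightarrow> sat M e \<phi> = sat M e' \<phi>"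
proof (induction \<phi> arbitrary: e e')
  case (Eql s t)
  then have "tm_val M e s = tm_val M e' s" "tm_val M e t = tm_val M e' t"
    by (auto intro!: tm_val_cong)
  then show ?case by simp
next
  case (Rel r ts)
  then have "map (tm_val M e) ts = map (tm_val M e') ts"
    by (auto intro!: map_cong tm_val_cong)
  then show ?case by (simp del: map_eq_conv)
next
  case (Neg \<phi>)
  from Neg.IH[of e e'] Neg.prems show ?case by simp
next
  case (Conj \<phi> \<psi>)
  from Conj.IH[of e e'] Conj.prems show ?case by simp
next
  case (Exi v \<phi>)
  have "sat M (e(v := a)) \<phi> = sat M (e'(v := a)) \<phi>" for a
    using Exi.prems by (intro Exi.IH) auto
  then show ?case by simp
qed

lemma finite_tm_vars: "finite (tm_vars t)"
  by (induction t) auto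

lemma finite_tm_params: "finite (tm_params t)"
  by (induction t) auto

lemma finite_fm_free: "finite (fm_free \<phi>)"
  by (induction \<phi>) (auto simp: finite_tm_vars)

lemma finite_fm_params: "finite (fm_params \<phi>)"
  by (induction \<phi>) (auto simp: finite_tm_params)

text \<open>\<open>wf_fm\<close> restricts neither parameters nor free variables, so this is
  definability with arbitrary parameters. Quantifying over environments hides the syntax:
  definability goals reduce to introduction rules that follow the shape of the predicate.\<close>

definition dfn :: "('f, 'r) language \<Rightarrow> ('a, 'f, 'r) fo_structure \<Rightarrow> ((nat \<Rightarrow> 'a) \<Rightarrow> bool) \<Rightarrow> bool" where
  "dfn L M P \<longleftrightarrow> (\<exists>\<phi>. wf_fm L \<phi> \<and> (\<forall>e. sat M e \<phi> = P e))"

definition dtm :: "('f, 'r) language \<Rightarrow> ('a, 'f, 'r) fo_structure \<Rightarrow> ((nat \<Rightarrow> 'a) \<Rightarrow> 'a) \<Rightarrow> bool" where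
  "dtm L M f \<longleftrightarrow> (\<exists>t. wf_tm L t \<and> (\<forall>e. tm_val M e t = f e))"

section \<open>Closure of definability under logical operations\<close>

lemma dfn_neg: "dfn L M P \<Longrightarrow> dfn L M (\<lambda>e. \<not> P e)"
  unfolding dfn_def by (metis sat.simps(3) wf_fm.simps(3))

lemma dfn_conj: "dfn L M P \<Longrightarrow> dfn L M Q \<Longrightarrow> dfn L M (\<lambda>e. P e \<and> Q e)"
  unfolding dfn_def by (metis sat.simps(4) wf_fm.simps(4))

lemma dfn_disj:
  assumes "dfn L M P" "dfn L M Q"
  shows "dfn L M (\<lambda>e. P e \<or> Q e)"
proof -
  have "dfn L M (\<lambda>e. \<not> (\<not> P e \<and> \<not> Q e))"
    by (rule dfn_neg, rule dfn_conj; rule dfn_neg; fact)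
  then show ?thesis by simp
qed

lemma dfn_eq: "dtm L M f \<Longrightarrow> dtm L M g \<Longrightarrow> dfn L M (\<lambda>e. f e = g e)"
  unfolding dfn_def dtm_def by (metis sat.simps(1) wf_fm.simps(1))

text \<open>The second premise says that \<open>v\<close> is fresh: \<open>Q\<close> does not look at it.\<close>

lemma dfn_ex:
  assumes "dfn L M (\<lambda>e. Q e (e v))" "\<And>e a b. Q (e(v := b)) a = Q e a"
  shows "dfn L M (\<lambda>e. \<exists>a. Q e a)"
proof -
  obtain \<phi> where "wf_fm L \<phi>" "\<And>e. sat M e \<phi> = Q e (e v)"
    using assms(1) unfolding dfn_def by blast
  then have "wf_fm L (Exi v \<phi>)" "\<And>e. sat M e (Exi v \<phi>) = (\<exists>a. Q e a)"
    using assms(2) by auto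
  then show ?thesis unfolding dfn_def by blast
qed

lemma dtm_var: "dtm L M (\<lambda>e. e v)"
  unfolding dtm_def by (rule exI[of _ "Var v"]) auto

lemma dtm_const: "dtm L M (\<lambda>e. c)"
  unfolding dtm_def by (rule exI[of _ "Par c"]) auto

lemma dfn_const: "dfn L M (\<lambda>e. b)"
proof (cases b)
  case True
  then show ?thesis using dfn_eq[OF dtm_const dtm_const, of L M undefined undefined] by simp
next
  case False
  then show ?thesis using dfn_neg[OF dfn_eq[OF dtm_const dtm_const, of L M undefined undefined]] by simp
qed

text \<open>Quantifying \<open>v\<close> and demanding \<open>v = c v\<close> has the effect of
  substitution, so no capture can occur. Finitely many variables are handled one at a time.\<close>

lemma substitute_constants:
  fixes M :: "('a, 'f, 'r) fo_structure"
  assumes "wf_fm L \<phi>" "finite I"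
  obtains \<psi> where "wf_fm L \<psi>" "fm_free \<psi> = fm_free \<phi> - I"
    "\<And>e. sat M e \<psi> = sat M (\<lambda>i. if i \<in> I then c i else e i) \<phi>"
proof -
  from assms(2) have "\<exists>\<psi>. wf_fm L \<psi> \<and> fm_free \<psi> = fm_free \<phi> - I \<and>
    (\<forall>e. sat M e \<psi> = sat M (\<lambda>i. if i \<in> I then c i else e i) \<phi>)"
  proof (induction I)
    case empty
    then show ?case using assms(1) by auto
  next
    case (insert v I)
    then obtain \<psi> where \<psi>: "wf_fm L \<psi>" "fm_free \<psi> = fm_free \<phi> - I"
      "\<And>e. sat M e \<psi> = sat M (\<lambda>i. if i \<in> I then c i else e i) \<phi>" by blast
    have "(\<lambda>i. if i \<in> I then c i else (e(v := c v)) i) =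
      (\<lambda>i. if i \<in> insert v I then c i else e i)" for e
      by auto
    then have "sat M e (Exi v (Conj (Eql (Var v) (Par (c v))) \<psi>)) =
      sat M (\<lambda>i. if i \<in> insert v I then c i else e i) \<phi>" for e
      using \<psi>(3)[of "e(v := c v)"] by simp
    moreover have "wf_fm L (Exi v (Conj (Eql (Var v) (Par (c v))) \<psi>))" using \<psi>(1) by simp
    moreover have "fm_free (Exi v (Conj (Eql (Var v) (Par (c v))) \<psi>)) = fm_free \<phi> - insert v I"
      using \<psi>(2) by auto
    ultimately show ?case by blast
  qed
  then show ?thesis using that by blast
qed

lemma dfn_substitute_constants:
  assumes "dfn L M P" "finite I"
  shows "dfn L M (\<lambda>e. P (\<lambda>i. if i \<in> I then c i else e i))"
  using assms unfolding dfn_def by (metis substitute_constants)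

text \<open>A formula for \<open>P\<close> may have stray free variables from n on. Fixing them to a
  constant does not change its truth value, because \<open>P\<close> looks only at the first n
  coordinates.\<close>

lemma definable_if_dfn:
  assumes "dfn L M P" "\<And>e e'. (\<And>i. i < n \<Longrightarrow> e i = e' i) \<Longrightarrow> P e = P e'"
  shows "definable L M n {xs. length xs = n \<and> P ((!) xs)}"
proof -
  obtain \<phi> where \<phi>: "wf_fm L \<phi>" "\<And>e. sat M e \<phi> = P e"
    using assms(1) unfolding dfn_def by blast
  obtain \<psi> where \<psi>: "wf_fm L \<psi>" "fm_free \<psi> = fm_free \<phi> - (fm_free \<phi> - {..<n})"
    "\<And>e. sat M e \<psi> = sat M (\<lambda>i. if i \<in> fm_free \<phi> - {..<n} then undefined else e i) \<phi>"
    using substitute_constants[OF \<phi>(1), of "fm_free \<phi> - {..<n}" M "\<lambda>_. undefined"] finite_fm_free by blast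
  have "sat M e \<psi> = P e" for e
    unfolding \<psi>(3) \<phi>(2) by (rule assms(2)) auto
  then have "{xs. length xs = n \<and> P ((!) xs)} = solutions M n \<psi>"
    unfolding solutions_def by auto
  then show ?thesis
    using \<psi> unfolding definable_def definable_over_def formulas_def by auto
qed

lemma dfn_if_definable_over:
  assumes "definable_over L M A n X"
  shows "\<exists>\<phi>. wf_fm L \<phi> \<and> fm_free \<phi> \<subseteq> {..<n} \<and> (\<forall>xs. length xs = n \<longrightarrow> sat M ((!) xs) \<phi> = (xs \<in> X))"
  using assms unfolding definable_over_def formulas_def solutions_def by blast

definition dset :: "('f, 'r) language \<Rightarrow> ('a, 'f, 'r) fo_structure \<Rightarrow> 'a set \<Rightarrow> bool" where
  "dset L M X \<longleftrightarrow> definable L M 1 (singles X)"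

lemma singles_conv: "singles X = {xs. length xs = 1 \<and> xs ! 0 \<in> X}"
  unfolding singles_def by (auto simp: length_Suc_conv)

lemma dset_iff_dfn: "dset L M X \<longleftrightarrow> dfn L M (\<lambda>e. e 0 \<in> X)"
proof
  assume "dset L M X"
  then obtain \<phi> where \<phi>: "wf_fm L \<phi>" "fm_free \<phi> \<subseteq> {..<1}"
    "\<And>xs. length xs = 1 \<Longrightarrow> sat M ((!) xs) \<phi> = (xs \<in> singles X)"
    using dfn_if_definable_over unfolding dset_def definable_def by metis
  have "sat M e \<phi> = (e 0 \<in> X)" for e
  proof -
    have "sat M e \<phi> = sat M ((!) [e 0]) \<phi>"
      using \<phi>(2) by (intro sat_cong) auto
    also have "\<dots> = (e 0 \<in> X)" using \<phi>(3)[of "[e 0]"] by (auto simp: singles_def)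
    finally show ?thesis .
  qed
  then show "dfn L M (\<lambda>e. e 0 \<in> X)" using \<phi>(1) unfolding dfn_def by blast
next
  assume "dfn L M (\<lambda>e. e 0 \<in> X)"
  from definable_if_dfn[OF this, of 1] show "dset L M X"
    unfolding dset_def singles_conv by simp
qed

lemma dfn_mem:
  assumes "dset L M X" "dtm L M f"
  shows "dfn L M (\<lambda>e. f e \<in> X)"
proof -
  obtain \<phi> where \<phi>: "wf_fm L \<phi>" "\<And>e. sat M e \<phi> = (e 0 \<in> X)"
    using assms(1) unfolding dset_iff_dfn dfn_def by blast
  obtain t where t: "wf_tm L t" "\<And>e. tm_val M e t = f e"
    using assms(2) unfolding dtm_def by blast
  \<comment> \<open>The value of \<open>t\<close> passes through a fresh variable, because
    \<open>t\<close> itself may contain variable 0.\<close>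
  obtain N where N: "N \<notin> insert 0 (tm_vars t)"
    using ex_new_if_finite[OF infinite_UNIV_nat, of "insert 0 (tm_vars t)"] finite_tm_vars by auto
  let ?\<psi> = "Exi N (Conj (Eql (Var N) t) (Exi 0 (Conj (Eql (Var 0) (Var N)) \<phi>)))"
  have "tm_val M (e(N := a)) t = f e" for e a
    unfolding t(2)[symmetric] using N by (intro tm_val_cong) auto
  then have "sat M e ?\<psi> = (f e \<in> X)" for e
    using \<phi>(2) N by auto
  moreover have "wf_fm L ?\<psi>" using \<phi> t by simp
  ultimately show ?thesis unfolding dfn_def by blast
qed

section \<open>Definability of families and compactness\<close>

fun fm_vars :: "('a, 'f, 'r) fm \<Rightarrow> nat set" where
  "fm_vars (Eql s t) = tm_vars s \<union> tm_vars t"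
| "fm_vars (Rel r ts) = (\<Union>t\<in>set ts. tm_vars t)"
| "fm_vars (Neg \<phi>) = fm_vars \<phi>"
| "fm_vars (Conj \<phi> \<psi>) = fm_vars \<phi> \<union> fm_vars \<psi>"
| "fm_vars (Exi v \<phi>) = insert v (fm_vars \<phi>)"

lemma finite_fm_vars: "finite (fm_vars \<phi>)"
  by (induction \<phi>) (auto simp: finite_tm_vars)

fun abs_tm :: "('a \<Rightarrow> nat) \<Rightarrow> ('a, 'f) tm \<Rightarrow> ('a, 'f) tm" where
  "abs_tm g (Var v) = Var v"
| "abs_tm g (Par a) = Var (g a)"
| "abs_tm g (App f ts) = App f (map (abs_tm g) ts)"

fun abs_fm :: "('a \<Rightarrow> nat) \<Rightarrow> ('a, 'f, 'r) fm \<Rightarrow> ('a, 'f, 'r) fm" where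
  "abs_fm g (Eql s t) = Eql (abs_tm g s) (abs_tm g t)"
| "abs_fm g (Rel r ts) = Rel r (map (abs_tm g) ts)"
| "abs_fm g (Neg \<phi>) = Neg (abs_fm g \<phi>)"
| "abs_fm g (Conj \<phi> \<psi>) = Conj (abs_fm g \<phi>) (abs_fm g \<psi>)"
| "abs_fm g (Exi v \<phi>) = Exi v (abs_fm g \<phi>)"

lemma wf_abs_tm: "wf_tm L t \<Longrightarrow> wf_tm L (abs_tm g t)"
  by (induction t) auto

lemma wf_abs_fm: "wf_fm L \<phi> \<Longrightarrow> wf_fm L (abs_fm g \<phi>)"
  by (induction \<phi>) (auto simp: wf_abs_tm)

lemma params_abs_tm: "tm_params (abs_tm g t) = {}"
  by (induction t) auto

lemma params_abs_fm: "fm_params (abs_fm g \<phi>) = {}"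
  by (induction \<phi>) (auto simp: params_abs_tm)

lemma vars_abs_tm: "tm_vars (abs_tm g t) \<subseteq> tm_vars t \<union> g ` tm_params t"
  by (induction t) fastforce+

lemma free_abs_fm: "fm_free (abs_fm g \<phi>) \<subseteq> fm_free \<phi> \<union> g ` fm_params \<phi>"
proof (induction \<phi>)
  case (Eql s t)
  then show ?case using vars_abs_tm[of g s] vars_abs_tm[of g t] by auto
next
  case (Rel r ts)
  then show ?case using vars_abs_tm[of g] by fastforce
qed auto

lemma tm_val_abs: "(\<And>a. a \<in> tm_params t \<Longrightarrow> e (g a) = a) \<Longrightarrow> tm_val M e (abs_tm g t) = tm_val M e t"
proof (induction t)
  case (App f ts)
  then have "map (tm_val M e \<circ> abs_tm g) ts = map (tm_val M e) ts"
    by (auto intro!: map_cong)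
  then show ?case by (simp del: map_eq_conv)
qed auto

text \<open>The variables \<open>g a\<close> avoid bound variables as well as free ones, so no
  quantifier of the formula overwrites the value \<open>a\<close> stored at
  \<open>g a\<close>.\<close>

lemma sat_abs:
  "(\<And>a. a \<in> fm_params \<phi> \<Longrightarrow> e (g a) = a \<and> g a \<notin> fm_vars \<phi>) \<Longrightarrow>
    sat M e (abs_fm g \<phi>) = sat M e \<phi>"
proof (induction \<phi> arbitrary: e)
  case (Eql s t)
  then show ?case by (simp add: tm_val_abs)
next
  case (Rel r ts)
  then have "map (tm_val M e \<circ> abs_tm g) ts = map (tm_val M e) ts"
    by (auto intro!: map_cong tm_val_abs)
  then show ?case by (simp del: map_eq_conv)
next
  case (Neg \<phi>)
  then show ?case by simp
next
  case (Conj \<phi> \<psi>)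
  then show ?case by simp
next
  case (Exi v \<phi>)
  have "sat M (e(v := a)) (abs_fm g \<phi>) = sat M (e(v := a)) \<phi>" for a
    using Exi.prems by (intro Exi.IH) auto
  then show ?case by simp
qed

text \<open>A formula \<open>\<phi>(x, y)\<close> with parameters is an instance of one without: its parameters become
  variables beyond all variables of \<open>\<phi>\<close>, and the unused variables in between are filled with
  arbitrary elements.\<close>

lemma parameter_free_instance:
  assumes "dfn L M (\<lambda>e. Q (e 0) (e 1))"
  obtains cs k \<psi> where "length cs = k" "\<psi> \<in> formulas L {} (1 + (1 + k))"
    "\<And>x a. sat M ((!) ([x] @ [a] @ cs)) \<psi> = Q x a"
proof -
  have "definable L M 2 {xs. length xs = 2 \<and> Q (xs ! 0) (xs ! 1)}"
    using definable_if_dfn[OF assms, of 2] by simp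
  then obtain \<phi> where \<phi>: "wf_fm L \<phi>" "fm_free \<phi> \<subseteq> {..<2}"
    "\<And>xs. length xs = 2 \<Longrightarrow> sat M ((!) xs) \<phi> = Q (xs ! 0) (xs ! 1)"
    using dfn_if_definable_over[of L M UNIV 2] unfolding definable_def by fastforce
  define N where "N = Suc (Max (insert 1 (fm_vars \<phi>)))"
  have N: "v < N" if "v \<in> fm_vars \<phi>" for v
    using that finite_fm_vars[of \<phi>] unfolding N_def by (simp add: le_imp_less_Suc)
  have N2: "2 \<le> N"
    using Max_ge[of "insert 1 (fm_vars \<phi>)" 1] finite_fm_vars[of \<phi>] unfolding N_def by simp
  obtain ps where ps: "set ps = fm_params \<phi>"
    using finite_list[OF finite_fm_params[of \<phi>]] by auto
  define g where "g a = N + (SOME i. i < length ps \<and> ps ! i = a)" for a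
  have g: "\<exists>i<length ps. ps ! i = a \<and> g a = N + i" if "a \<in> fm_params \<phi>" for a
  proof -
    from that have "a \<in> set ps" using ps by simp
    then have "\<exists>i. i < length ps \<and> ps ! i = a" unfolding in_set_conv_nth .
    from someI_ex[OF this] show ?thesis unfolding g_def by auto
  qed
  \<comment> \<open>The padding has length N - 2 because x and a occupy positions 0 and 1; thus
    \<open>ps ! i\<close> lands at position N + i.\<close>
  define cs where "cs = replicate (N - 2) undefined @ ps"
  have nth: "([x] @ [a] @ cs) ! (N + i) = ps ! i" for x a i
    using nth_append_length_plus[of "[x] @ [a] @ replicate (N - 2) undefined" ps i] N2
    unfolding cs_def by (simp add: numeral_2_eq_2)
  have "sat M ((!) ([x] @ [a] @ cs)) (abs_fm g \<phi>) = Q x a" for x a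
  proof -
    have "sat M ((!) ([x] @ [a] @ cs)) (abs_fm g \<phi>) = sat M ((!) ([x] @ [a] @ cs)) \<phi>"
    proof (rule sat_abs)
      fix b assume "b \<in> fm_params \<phi>"
      then obtain i where i: "ps ! i = b" "g b = N + i" using g by blast
      then have "g b \<notin> fm_vars \<phi>" using N[of "g b"] by auto
      then show "([x] @ [a] @ cs) ! g b = b \<and> g b \<notin> fm_vars \<phi>"
        using nth i by metis
    qed
    also have "\<dots> = sat M ((!) [x, a]) \<phi>"
      using \<phi>(2) by (intro sat_cong) (auto simp: nth_Cons')
    also have "\<dots> = Q x a" using \<phi>(3)[of "[x, a]"] by simp
    finally show ?thesis .
  qed
  moreover have "abs_fm g \<phi> \<in> formulas L {} (1 + (1 + length cs))"
  proof -
    have "g a < 1 + (1 + length cs)" if "a \<in> fm_params \<phi>" for a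
      using g[OF that] N2 unfolding cs_def by auto
    then have "fm_free (abs_fm g \<phi>) \<subseteq> {..<1 + (1 + length cs)}"
      using free_abs_fm[of g \<phi>] \<phi>(2) by fastforce
    then show ?thesis
      using \<phi>(1) unfolding formulas_def by (simp add: wf_abs_fm params_abs_fm)
  qed
  ultimately show ?thesis using that by blast
qed

text \<open>The axiom concerns families without parameters. The parameters of \<open>Q\<close> are
  therefore treated as k further parameter variables, and the resulting separating set is cut down
  to the slice where these take their original values \<open>cs\<close>.\<close>

lemma (in continuous_dimension) continuity_family:
  assumes "dfn L M (\<lambda>e. Q (e 0) (e 1))" "0 \<le> s" "s < t"
  obtains D where "dset L M D" "\<And>a. \<delta> (singles {x. Q x a}) \<le> ennreal s \<Longrightarrow> a \<in> D"
    "\<And>a. a \<in> D \<Longrightarrow> \<delta> (singles {x. Q x a}) < ennreal t"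
proof -
  obtain k cs \<psi> where \<psi>: "length cs = k" "\<psi> \<in> formulas L {} (1 + (1 + k))"
    "\<And>x a. sat M ((!) ([x] @ [a] @ cs)) \<psi> = Q x a"
    by (rule parameter_free_instance[OF assms(1)], rule that)
  obtain D where D: "definable_over L M {} (1 + k) D"
    "{a. length a = 1 + k \<and>
      \<delta> {x. length x = 1 \<and> x @ a \<in> solutions M (1 + (1 + k)) \<psi>} \<le> ennreal s} \<subseteq> D"
    "D \<subseteq> {b. length b = 1 + k \<and>
      \<delta> {x. length x = 1 \<and> x @ b \<in> solutions M (1 + (1 + k)) \<psi>} < ennreal t}"
    using dim_continuity[OF \<psi>(2) assms(2,3)] by blast
  have fam: "{x. length x = 1 \<and> x @ ([a] @ cs) \<in> solutions M (1 + (1 + k)) \<psi>} = singles {x. Q x a}"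
    for a
    using \<psi>(1,3) unfolding solutions_def singles_def by (auto simp: length_Suc_conv)
  obtain \<theta> where \<theta>: "wf_fm L \<theta>" "fm_free \<theta> \<subseteq> {..<1 + k}"
    "\<And>xs. length xs = 1 + k \<Longrightarrow> sat M ((!) xs) \<theta> = (xs \<in> D)"
    using dfn_if_definable_over[OF D(1)] by blast
  have "dfn L M (\<lambda>e. sat M e \<theta>)" using \<theta>(1) unfolding dfn_def by blast
  \<comment> \<open>Coordinate 0 stays free for the element a, so coordinate i carries
    \<open>cs ! (i - 1)\<close>.\<close>
  from dfn_substitute_constants[OF this, of "{1..k}" "\<lambda>i. cs ! (i - 1)"]
  have *: "dfn L M (\<lambda>e. sat M (\<lambda>i. if i \<in> {1..k} then cs ! (i - 1) else e i) \<theta>)" by simp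
  have "sat M (\<lambda>i. if i \<in> {1..k} then cs ! (i - 1) else e i) \<theta> = ([e 0] @ cs \<in> D)" for e
  proof -
    have "sat M (\<lambda>i. if i \<in> {1..k} then cs ! (i - 1) else e i) \<theta> = sat M ((!) ([e 0] @ cs)) \<theta>"
      using \<theta>(2) by (intro sat_cong) (auto simp: nth_Cons' split: if_splits)
    also have "\<dots> = ([e 0] @ cs \<in> D)" using \<theta>(3) \<psi>(1) by simp
    finally show ?thesis .
  qed
  then have "dset L M {a. [a] @ cs \<in> D}"
    using * unfolding dset_iff_dfn by simp
  moreover have "a \<in> {a. [a] @ cs \<in> D}" if "\<delta> (singles {x. Q x a}) \<le> ennreal s" for a
    using that D(2) fam[of a] \<psi>(1) by auto
  moreover have "\<delta> (singles {x. Q x a}) < ennreal t" if "a \<in> {a. [a] @ cs \<in> D}" for a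
    using that D(3) fam[of a] by auto
  ultimately show ?thesis using that by blast
qed

text \<open>If no finite part of the type enforced \<open>Q\<close>, four copies of the type
  together with the negation of \<open>Q\<close> would be finitely satisfiable. Saturation would
  then realize them by a quadruple from \<open>Y\<close> that violates \<open>Q\<close>. The
  finitely many formulas that do enforce it define \<open>B\<close>.\<close>

lemma compactness_quadruples:
  fixes M :: "('a, 'f, 'r) fo_structure"
  assumes sat: "sufficiently_saturated \<kappa> L M" and A: "|A| <o \<kappa>"
    and Y: "type_definable L M A 1 (singles Y)"
    and Q: "dfn L M (\<lambda>e. Q (e 0) (e 1) (e 2) (e 3))"
    and QY: "\<And>y0 y1 y2 y3. y0 \<in> Y \<Longrightarrow> y1 \<in> Y \<Longrightarrow> y2 \<in> Y \<Longrightarrow> y3 \<in> Y \<Longrightarrow> Q y0 y1 y2 y3"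
  obtains B where "dset L M B" "Y \<subseteq> B"
    "\<And>b0 b1 b2 b3. b0 \<in> B \<Longrightarrow> b1 \<in> B \<Longrightarrow> b2 \<in> B \<Longrightarrow> b3 \<in> B \<Longrightarrow> Q b0 b1 b2 b3"
proof -
  have saturated: "saturated \<kappa> L M" using sat unfolding sufficiently_saturated_def by simp
  obtain \<Gamma> where \<Gamma>: "partial_type L M A 1 \<Gamma>" "singles Y = realizations M 1 \<Gamma>"
    using Y unfolding type_definable_def by blast
  have \<Gamma>f: "wf_fm L \<gamma>" "fm_params \<gamma> \<subseteq> A" "fm_free \<gamma> \<subseteq> {..<1}" if "\<gamma> \<in> \<Gamma>" for \<gamma>
    using that \<Gamma>(1) unfolding partial_type_def formulas_def by auto
  have "definable L M 4 {xs. length xs = 4 \<and> Q (xs ! 0) (xs ! 1) (xs ! 2) (xs ! 3)}"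
    using definable_if_dfn[OF Q, of 4] by simp
  then obtain \<phi> where \<phi>: "\<phi> \<in> formulas L UNIV 4"
    "{xs. length xs = 4 \<and> Q (xs ! 0) (xs ! 1) (xs ! 2) (xs ! 3)} = solutions M 4 \<phi>"
    unfolding definable_def definable_over_def by blast
  have \<phi>s: "sat M ((!) xs) \<phi> = Q (xs ! 0) (xs ! 1) (xs ! 2) (xs ! 3)" if "length xs = 4" for xs
    using \<phi>(2) that unfolding solutions_def by blast
  \<comment> \<open>\<open>mv i \<gamma>\<close> asserts \<open>\<gamma>\<close>, a formula in
    variable 0, of variable i; an equation under a quantifier takes the place of renaming.\<close>
  define mv :: "nat \<Rightarrow> ('a, 'f, 'r) fm \<Rightarrow> ('a, 'f, 'r) fm" where
    "mv i \<gamma> = (if i = 0 then \<gamma> else Exi 0 (Conj (Eql (Var 0) (Var i)) \<gamma>))" for i \<gamma>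
  have mv: "sat M e (mv i \<gamma>) = sat M (\<lambda>_. e i) \<gamma>" if "\<gamma> \<in> \<Gamma>" for e i \<gamma>
  proof -
    have "sat M e' \<gamma> = sat M (\<lambda>_. e' 0) \<gamma>" for e'
      using \<Gamma>f(3)[OF that] by (intro sat_cong) auto
    from this[of e] this[of "e(0 := e i)"] show ?thesis unfolding mv_def by simp
  qed
  have mvf: "mv i \<gamma> \<in> formulas L (A \<union> fm_params \<phi>) 4" if "\<gamma> \<in> \<Gamma>" "i < 4" for i \<gamma>
    using \<Gamma>f[OF that(1)] that(2) unfolding mv_def formulas_def by auto
  have Y_iff: "y \<in> Y \<longleftrightarrow> (\<forall>\<gamma>\<in>\<Gamma>. sat M (\<lambda>_. y) \<gamma>)" for y
  proof -
    have "y \<in> Y \<longleftrightarrow> [y] \<in> realizations M 1 \<Gamma>"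
      unfolding \<Gamma>(2)[symmetric] singles_def by auto
    also have "\<dots> \<longleftrightarrow> (\<forall>\<gamma>\<in>\<Gamma>. sat M ((!) [y]) \<gamma>)" unfolding realizations_def by simp
    also have "\<dots> \<longleftrightarrow> (\<forall>\<gamma>\<in>\<Gamma>. sat M (\<lambda>_. y) \<gamma>)"
    proof (rule ball_cong[OF refl])
      fix \<gamma> assume "\<gamma> \<in> \<Gamma>"
      then show "sat M ((!) [y]) \<gamma> = sat M (\<lambda>_. y) \<gamma>"
        using \<Gamma>f(3)[of \<gamma>] by (intro sat_cong) auto
    qed
    finally show ?thesis .
  qed
  define \<Gamma>' where "\<Gamma>' = case_prod mv ` ({..<4} \<times> \<Gamma>) \<union> {Neg \<phi>}"
  \<comment> \<open>The parameters of \<open>Q\<close> have to join \<open>A\<close>; they are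
    finite in number, so the union is still small.\<close>
  have small: "|A \<union> fm_params \<phi>| <o \<kappa>"
  proof -
    have \<kappa>: "Card_order \<kappa>" "natLeq <o \<kappa>" using sat unfolding sufficiently_saturated_def by auto
    have "|fm_params \<phi>| <o \<kappa>"
      using finite_fm_params \<kappa>(2) finite_iff_ordLess_natLeq ordLess_transitive by blast
    moreover have "\<not> finite (Field \<kappa>)"
      using cinfinite_mono[OF ordLess_imp_ordLeq[OF \<kappa>(2)] natLeq_cinfinite]
      unfolding cinfinite_def .
    ultimately show ?thesis
      using card_of_Un_ordLess_infinite_Field[OF _ \<kappa>(1) A] by blast
  qed
  have "\<not> partial_type L M (A \<union> fm_params \<phi>) 4 \<Gamma>'"
  proof
    assume "partial_type L M (A \<union> fm_params \<phi>) 4 \<Gamma>'"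
    with saturated small have "realizations M 4 \<Gamma>' \<noteq> {}" unfolding saturated_def by blast
    then obtain xs where xs: "length xs = 4" "\<And>\<psi>. \<psi> \<in> \<Gamma>' \<Longrightarrow> sat M ((!) xs) \<psi>"
      unfolding realizations_def by blast
    have "xs ! i \<in> Y" if "i < 4" for i
      unfolding Y_iff
    proof
      fix \<gamma> assume "\<gamma> \<in> \<Gamma>"
      moreover from this that have "mv i \<gamma> \<in> \<Gamma>'" unfolding \<Gamma>'_def by (auto intro!: image_eqI[of _ _ "(i, \<gamma>)"])
      ultimately show "sat M (\<lambda>_. xs ! i) \<gamma>" using xs(2) mv by blast
    qed
    then have "Q (xs ! 0) (xs ! 1) (xs ! 2) (xs ! 3)" using QY by simp
    then show False using xs(2)[of "Neg \<phi>"] \<phi>s[OF xs(1)] unfolding \<Gamma>'_def by simp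
  qed
  moreover have "\<Gamma>' \<subseteq> formulas L (A \<union> fm_params \<phi>) 4"
    using mvf \<phi>(1) unfolding \<Gamma>'_def formulas_def by auto
  ultimately have "\<exists>\<Delta>. \<Delta> \<subseteq> \<Gamma>' \<and> finite \<Delta> \<and> \<not> (\<exists>xs. length xs = 4 \<and> (\<forall>\<psi>\<in>\<Delta>. sat M ((!) xs) \<psi>))"
    unfolding partial_type_def by simp
  then obtain \<Delta> where \<Delta>: "\<Delta> \<subseteq> \<Gamma>'" "finite \<Delta>"
    "\<not> (\<exists>xs. length xs = 4 \<and> (\<forall>\<psi>\<in>\<Delta>. sat M ((!) xs) \<psi>))"
    by blast
  have sub: "\<Delta> - {Neg \<phi>} \<subseteq> case_prod mv ` ({..<4} \<times> \<Gamma>)" using \<Delta>(1) unfolding \<Gamma>'_def by blast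
  have "finite (\<Delta> - {Neg \<phi>})" using \<Delta>(2) by simp
  from finite_subset_image[OF this sub]
  obtain C where C: "C \<subseteq> {..<4} \<times> \<Gamma>" "finite C" "\<Delta> - {Neg \<phi>} = case_prod mv ` C"
    by auto
  \<comment> \<open>Formulas used at any of the four coordinates are pooled, so that one set
    \<open>B\<close> serves all coordinates.\<close>
  define \<Delta>0 where "\<Delta>0 = snd ` C"
  have \<Delta>0: "finite \<Delta>0" "\<Delta>0 \<subseteq> \<Gamma>" using C unfolding \<Delta>0_def by auto
  define B where "B = {x. \<forall>\<gamma>\<in>\<Delta>0. sat M (\<lambda>_. x) \<gamma>}"
  have "dfn L M (\<lambda>e. \<forall>\<gamma>\<in>\<Delta>0. sat M (\<lambda>_. e 0) \<gamma>)" using \<Delta>0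
  proof (induction \<Delta>0)
    case empty
    show ?case using dfn_const[of L M True] by simp
  next
    case (insert \<gamma> \<Delta>0)
    have "sat M e \<gamma> = sat M (\<lambda>_. e 0) \<gamma>" for e
      using \<Gamma>f(3)[of \<gamma>] insert.prems by (intro sat_cong) auto
    then have "dfn L M (\<lambda>e. sat M (\<lambda>_. e 0) \<gamma>)"
      using \<Gamma>f(1)[of \<gamma>] insert.prems unfolding dfn_def by auto
    then show ?case using insert.IH insert.prems dfn_conj by simp
  qed
  then have "dset L M B" unfolding dset_iff_dfn B_def by simp
  moreover have "Y \<subseteq> B" using \<Delta>0(2) Y_iff unfolding B_def by blast
  moreover have "Q b0 b1 b2 b3" if b: "b0 \<in> B" "b1 \<in> B" "b2 \<in> B" "b3 \<in> B" for b0 b1 b2 b3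
  proof (rule ccontr)
    assume nQ: "\<not> Q b0 b1 b2 b3"
    define xs where "xs = [b0, b1, b2, b3]"
    have xs: "length xs = 4" "\<And>i. i < 4 \<Longrightarrow> xs ! i \<in> B"
      using b unfolding xs_def by (auto simp: nth_Cons' numeral_eq_Suc less_Suc_eq)
    obtain \<psi> where \<psi>: "\<psi> \<in> \<Delta>" "\<not> sat M ((!) xs) \<psi>" using \<Delta>(3) xs(1) by blast
    have "\<psi> \<noteq> Neg \<phi>" using \<psi>(2) \<phi>s[OF xs(1)] nQ unfolding xs_def by auto
    then have "\<psi> \<in> case_prod mv ` C" using C(3) \<psi>(1) by blast
    then obtain i \<gamma> where i\<gamma>: "(i, \<gamma>) \<in> C" "\<psi> = mv i \<gamma>" by auto
    then have "i < 4" "\<gamma> \<in> \<Gamma>" using C(1) by auto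
    moreover have "\<gamma> \<in> \<Delta>0" using imageI[OF i\<gamma>(1), of snd] unfolding \<Delta>0_def by simp
    ultimately show False using i\<gamma>(2) \<psi>(2) mv xs(2)[of i] unfolding B_def by auto
  qed
  ultimately show ?thesis using that by blast
qed

section \<open>Fibre inequalities for sets and binary relations\<close>

lemmas dfn_intros = dfn_conj dfn_disj dfn_neg dfn_eq dfn_mem dtm_var dtm_const

lemma dset_Collect: "dfn L M (\<lambda>e. P (e 0)) \<Longrightarrow> dset L M {z. P z}"
  by (simp add: dset_iff_dfn)

section \<open>Plane relations, graphs and sums of dilates\<close>

definition pset :: "('a \<Rightarrow> 'a \<Rightarrow> bool) \<Rightarrow> 'a list set" where
  "pset R = {[x, y] | x y. R x y}"

definition drel :: "('f, 'r) language \<Rightarrow> ('a, 'f, 'r) fo_structure \<Rightarrow> ('a \<Rightarrow> 'a \<Rightarrow> bool) \<Rightarrow> bool" where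
  "drel L M R \<longleftrightarrow> dfn L M (\<lambda>e. R (e 0) (e 1))"

text \<open>Only the graph over \<open>R\<close> has to be definable. Hence \<open>f\<close> need
  not be given by a term of the language and can be division.\<close>

definition dgraph ::
  "('f, 'r) language \<Rightarrow> ('a, 'f, 'r) fo_structure \<Rightarrow> ('a \<Rightarrow> 'a \<Rightarrow> bool) \<Rightarrow> ('a \<Rightarrow> 'a \<Rightarrow> 'a) \<Rightarrow> bool" where
  "dgraph L M R f \<longleftrightarrow> dfn L M (\<lambda>e. R (e 0) (e 1) \<and> e 2 = f (e 0) (e 1))"

text \<open>The sum of the dilates cA and c'B. Keeping both coefficients lets difference sets, Ruzsa
  distances between dilates and rescaling share one notion.\<close>

definition lin :: "'a::field \<Rightarrow> 'a set \<Rightarrow> 'a \<Rightarrow> 'a set \<Rightarrow> 'a set" where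
  "lin c A c' B = {z. \<exists>a b. a \<in> A \<and> b \<in> B \<and> z = c * a + c' * b}"

lemma linI: "a \<in> A \<Longrightarrow> b \<in> B \<Longrightarrow> z = c * a + c' * b \<Longrightarrow> z \<in> lin c A c' B"
  unfolding lin_def by blast

lemma linE:
  assumes "z \<in> lin c A c' B"
  obtains a b where "a \<in> A" "b \<in> B" "z = c * a + c' * b"
  using assms unfolding lin_def by blast

lemma lin_mono: "A \<subseteq> A' \<Longrightarrow> B \<subseteq> B' \<Longrightarrow> lin c A c' B \<subseteq> lin c A' c' B'"
  unfolding lin_def by blast

lemma pset_conv: "pset R = {xs. length xs = 2 \<and> R (xs ! 0) (xs ! 1)}"
proof -
  have "length xs = 2 \<longleftrightarrow> (\<exists>x y. xs = [x, y])" for xs :: "'a list"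
    by (auto simp: length_Suc_conv numeral_2_eq_2)
  then show ?thesis unfolding pset_def by auto
qed

lemma definable_pset: "drel L M R \<Longrightarrow> definable L M 2 (pset R)"
  unfolding drel_def pset_conv by (rule definable_if_dfn) simp_all

lemma singles_subset_iff: "singles X \<subseteq> singles Z \<longleftrightarrow> X \<subseteq> Z"
  unfolding singles_def by auto

lemma pset_subset_iff: "pset R \<subseteq> pset R' \<longleftrightarrow> (\<forall>x y. R x y \<longrightarrow> R' x y)"
  unfolding pset_def by auto

lemma ennreal_add_le_cancel:
  assumes "x + ennreal a \<le> ennreal b" "0 \<le> a"
  shows "x \<le> ennreal (b - a)"
proof (cases x)
  case (real r)
  \<comment> \<open>For negative b the value \<open>ennreal b\<close> is 0, which forces r =
    0.\<close>
  have "r + a \<le> b \<or> r = 0"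
    using assms real by (auto simp flip: ennreal_plus simp: ennreal_le_iff2)
  then show ?thesis
  proof
    assume "r + a \<le> b"
    then show ?thesis using real by (auto intro!: ennreal_leI)
  qed (simp add: real)
next
  case top
  then show ?thesis using assms by (simp add: top_unique)
qed

locale dim_field = continuous_dimension L M \<delta>
  for L :: "('f, 'r) language" and M :: "('a::field, 'f, 'r) fo_structure"
    and \<delta> :: "'a list set \<Rightarrow> ennreal" +
  assumes expands: "expands_field L M"
begin

abbreviation dim :: "'a set \<Rightarrow> ennreal" where "dim X \<equiv> \<delta> (singles X)"
abbreviation dim2 :: "('a \<Rightarrow> 'a \<Rightarrow> bool) \<Rightarrow> ennreal" where "dim2 R \<equiv> \<delta> (pset R)"

lemma dtm_add: "dtm L M f \<Longrightarrow> dtm L M g \<Longrightarrow> dtm L M (\<lambda>e. f e + g e)"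
proof -
  assume "dtm L M f" "dtm L M g"
  then obtain s t where st: "wf_tm L s" "wf_tm L t" "\<And>e. tm_val M e s = f e" "\<And>e. tm_val M e t = g e"
    unfolding dtm_def by blast
  obtain p where "(p, 2) \<in> Funs L" "\<And>x y. fun_int M p [x, y] = x + y"
    using expands unfolding expands_field_def by blast
  then have "wf_tm L (App p [s, t])" "\<And>e. tm_val M e (App p [s, t]) = f e + g e"
    using st by (auto simp: numeral_2_eq_2)
  then show ?thesis unfolding dtm_def by blast
qed

lemma dtm_mult: "dtm L M f \<Longrightarrow> dtm L M g \<Longrightarrow> dtm L M (\<lambda>e. f e * g e)"
proof -
  assume "dtm L M f" "dtm L M g"
  then obtain s t where st: "wf_tm L s" "wf_tm L t" "\<And>e. tm_val M e s = f e" "\<And>e. tm_val M e t = g e"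
    unfolding dtm_def by blast
  obtain p where "(p, 2) \<in> Funs L" "\<And>x y. fun_int M p [x, y] = x * y"
    using expands unfolding expands_field_def by blast
  then have "wf_tm L (App p [s, t])" "\<And>e. tm_val M e (App p [s, t]) = f e * g e"
    using st by (auto simp: numeral_2_eq_2)
  then show ?thesis unfolding dtm_def by blast
qed

lemma dtm_uminus: "dtm L M f \<Longrightarrow> dtm L M (\<lambda>e. - f e)"
  using dtm_mult[OF dtm_const[of L M "-1"]] by simp

lemma dtm_diff:
  assumes "dtm L M f" "dtm L M g"
  shows "dtm L M (\<lambda>e. f e - g e)"
  using dtm_add[OF assms(1) dtm_uminus[OF assms(2)]] by simp

lemmas dfn_field_intros = dfn_intros dtm_add dtm_mult dtm_uminus dtm_diff

section \<open>Monotonicity and sets of dimension zero\<close>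

lemma dim_mono_definable:
  assumes "definable L M n X" "definable L M n Z" "X \<subseteq> Z"
  shows "\<delta> X \<le> \<delta> Z"
  using dim_inter[OF assms(1,2)] assms(3) by (simp add: Int_absorb2)

lemma dim_mono: "dset L M X \<Longrightarrow> dset L M Z \<Longrightarrow> X \<subseteq> Z \<Longrightarrow> dim X \<le> dim Z"
  unfolding dset_def by (rule dim_mono_definable) (auto simp: singles_subset_iff)

lemma dim2_mono: "drel L M R \<Longrightarrow> drel L M R' \<Longrightarrow> (\<And>x y. R x y \<Longrightarrow> R' x y) \<Longrightarrow> dim2 R \<le> dim2 R'"
  by (rule dim_mono_definable[OF definable_pset definable_pset]) (auto simp: pset_subset_iff)

lemma dset_empty: "dset L M {}"
  using dset_Collect[OF dfn_const[of L M False]] by simp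

lemma dset_singleton: "dset L M {a}"
  using dset_Collect[OF dfn_eq[OF dtm_var[of L M 0] dtm_const[of L M a]]] by simp

lemma dset_Diff_singleton:
  assumes "dset L M X"
  shows "dset L M (X - {a})"
proof -
  have "dset L M {z. z \<in> X \<and> \<not> z = a}"
    by (rule dset_Collect, intro dfn_field_intros assms)
  then show ?thesis by (simp add: set_diff_eq)
qed

lemma dim_empty: "dim {} = 0"
  using dim_finite[of 1 "singles {}"] dset_empty unfolding dset_def singles_def by simp

lemma dim_singleton: "dim {a} = 0"
  using dim_finite[of 1 "singles {a}"] dset_singleton[of a] unfolding dset_def singles_def by simp

lemma nonempty_if_dim_ge: "ennreal a \<le> dim X \<Longrightarrow> 0 < a \<Longrightarrow> X \<noteq> {}"
  using dim_empty by (auto simp: ennreal_eq_0_iff)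

lemma dim_Diff_singleton:
  assumes "dset L M X"
  shows "dim (X - {a}) = dim X"
proof (cases "a \<in> X")
  case True
  then have "singles X = singles (X - {a}) \<union> singles {a}" unfolding singles_def by auto
  then have "dim X = max (dim (X - {a})) (dim {a})"
    using dim_union[of 1 "singles (X - {a})" "singles {a}"] dset_Diff_singleton[OF assms, of a]
      dset_singleton[of a]
    unfolding dset_def by simp
  then show ?thesis by (simp add: dim_singleton)
qed simp

lemma dim2_empty:
  assumes "\<And>x y. \<not> R x y"
  shows "dim2 R = 0"
proof -
  have "R = (\<lambda>x y. False)" using assms by auto
  moreover have "dim2 (\<lambda>x y. False) = 0"
    using dim_finite[of 2 "pset (\<lambda>x y. False)"] definable_pset[of L M "\<lambda>x y. False"]
      dfn_const[of L M False]
    unfolding drel_def pset_def by simp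
  ultimately show ?thesis by simp
qed

section \<open>Dimension of fibres and images\<close>

lemma drel_fibre:
  assumes "dgraph L M R f"
  shows "drel L M (\<lambda>x y. R x y \<and> f x y = w)"
proof -
  have "dfn L M (\<lambda>e. \<exists>z. (R (e 0) (e 1) \<and> z = f (e 0) (e 1)) \<and> z = w)"
    by (rule dfn_ex[where v = 2], rule dfn_conj, rule assms[unfolded dgraph_def],
        intro dfn_field_intros, simp)
  then show ?thesis unfolding drel_def by (simp add: conj_commute eq_commute)
qed

lemma drel_preimage:
  assumes "dgraph L M R f" "dset L M W"
  shows "drel L M (\<lambda>x y. R x y \<and> f x y \<in> W)"
    "dgraph L M (\<lambda>x y. R x y \<and> f x y \<in> W) f"
proof -
  have "dfn L M (\<lambda>e. \<exists>z. (R (e 0) (e 1) \<and> z = f (e 0) (e 1)) \<and> z \<in> W)"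
    by (rule dfn_ex[where v = 2], rule dfn_conj, rule assms(1)[unfolded dgraph_def],
        intro dfn_field_intros assms, simp)
  moreover have "(\<exists>z. (R x y \<and> z = f x y) \<and> z \<in> W) \<longleftrightarrow> R x y \<and> f x y \<in> W" for x y by blast
  ultimately show "drel L M (\<lambda>x y. R x y \<and> f x y \<in> W)" unfolding drel_def by simp
  have "dfn L M (\<lambda>e. (R (e 0) (e 1) \<and> e 2 = f (e 0) (e 1)) \<and> e 2 \<in> W)"
    by (rule dfn_conj, rule assms(1)[unfolded dgraph_def], intro dfn_field_intros assms)
  moreover have "((R x y \<and> z = f x y) \<and> z \<in> W) \<longleftrightarrow> (R x y \<and> f x y \<in> W) \<and> z = f x y" for x y z by blast
  ultimately show "dgraph L M (\<lambda>x y. R x y \<and> f x y \<in> W) f" unfolding dgraph_def by simp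
qed

lemma definable_surjection_pset:
  assumes "drel L M R" "dgraph L M R f" "dset L M W"
    and "\<And>x y. R x y \<Longrightarrow> f x y \<in> W" "\<And>w. w \<in> W \<Longrightarrow> \<exists>x y. R x y \<and> f x y = w"
  shows "definable_surjection L M 2 1 (pset R) (singles W) (\<lambda>xs. [f (xs ! 0) (xs ! 1)])"
proof -
  have "length zs = 3 \<longleftrightarrow> (\<exists>x y z. zs = [x, y, z])" for zs :: "'a list"
    by (auto simp: length_Suc_conv numeral_eq_Suc)
  then have "{xs @ [f (xs ! 0) (xs ! 1)] |xs. xs \<in> pset R} =
    {zs. length zs = 3 \<and> R (zs ! 0) (zs ! 1) \<and> zs ! 2 = f (zs ! 0) (zs ! 1)}"
    unfolding pset_def by auto
  moreover have "definable L M 3 {zs. length zs = 3 \<and> R (zs ! 0) (zs ! 1) \<and> zs ! 2 = f (zs ! 0) (zs ! 1)}"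
    using assms(2) unfolding dgraph_def by (rule definable_if_dfn) simp_all
  moreover have "(\<lambda>xs. [f (xs ! 0) (xs ! 1)]) ` pset R = singles W"
  proof
    show "(\<lambda>xs. [f (xs ! 0) (xs ! 1)]) ` pset R \<subseteq> singles W"
      using assms(4) unfolding pset_def singles_def by auto
    show "singles W \<subseteq> (\<lambda>xs. [f (xs ! 0) (xs ! 1)]) ` pset R"
    proof
      fix ws assume "ws \<in> singles W"
      then obtain w where w: "ws = [w]" "w \<in> W" unfolding singles_def by blast
      then obtain x y where xy: "R x y" "f x y = w" using assms(5) by blast
      then have "[x, y] \<in> pset R" "ws = [f ([x, y] ! 0) ([x, y] ! 1)]"
        using w unfolding pset_def by auto
      then show "ws \<in> (\<lambda>xs. [f (xs ! 0) (xs ! 1)]) ` pset R" by (rule rev_image_eqI)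
    qed
  qed
  ultimately show ?thesis
    using definable_pset[OF assms(1)] assms(3) unfolding definable_surjection_def dset_def by simp
qed

lemma fibre_pset:
  "{xs \<in> pset R. [f (xs ! 0) (xs ! 1)] = [w]} = pset (\<lambda>x y. R x y \<and> f x y = w)"
  unfolding pset_def by auto

text \<open>Here \<open>f\<close> may take values outside \<open>W\<close>. Restricting
  \<open>R\<close> to the preimage of \<open>W\<close> makes \<open>f\<close> a surjection onto
  \<open>W\<close> with unchanged fibres there, and monotonicity returns to
  \<open>R\<close>.\<close>

lemma fibre_lower2:
  assumes "drel L M R" "dgraph L M R f" "dset L M W" "W \<noteq> {}"
    and ex: "\<And>w. w \<in> W \<Longrightarrow> \<exists>x y. R x y \<and> f x y = w"
    and l: "\<And>w. w \<in> W \<Longrightarrow> l \<le> dim2 (\<lambda>x y. R x y \<and> f x y = w)"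
  shows "dim W + l \<le> dim2 R"
proof -
  define R' where "R' = (\<lambda>x y. R x y \<and> f x y \<in> W)"
  have R': "drel L M R'" "dgraph L M R' f"
    using drel_preimage[OF assms(2,3)] unfolding R'_def by auto
  have ex': "\<exists>x y. R' x y \<and> f x y = w" if "w \<in> W" for w
    using ex[OF that] that unfolding R'_def by blast
  have surj: "definable_surjection L M 2 1 (pset R') (singles W) (\<lambda>xs. [f (xs ! 0) (xs ! 1)])"
    using R' assms(3) ex' by (intro definable_surjection_pset) (auto simp: R'_def)
  have ne: "pset R' \<noteq> {}" "singles W \<noteq> {}"
    using ex' assms(4) unfolding pset_def singles_def by auto
  have "l \<le> (INF y\<in>singles W. \<delta> {xs \<in> pset R'. [f (xs ! 0) (xs ! 1)] = y})"
  proof (rule INF_greatest)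
    fix y assume "y \<in> singles W"
    then obtain w where w: "y = [w]" "w \<in> W" unfolding singles_def by blast
    then have "(\<lambda>x y. R' x y \<and> f x y = w) = (\<lambda>x y. R x y \<and> f x y = w)"
      unfolding R'_def by auto
    then show "l \<le> \<delta> {xs \<in> pset R'. [f (xs ! 0) (xs ! 1)] = y}"
      using l[OF w(2)] unfolding w(1) fibre_pset by simp
  qed
  then have "dim W + l \<le> dim W + (INF y\<in>singles W. \<delta> {xs \<in> pset R'. [f (xs ! 0) (xs ! 1)] = y})"
    by (rule add_left_mono)
  also have "\<dots> \<le> dim2 R'" by (rule dim_fibre_lower[OF surj ne])
  also have "\<dots> \<le> dim2 R" using R'(1) assms(1) by (rule dim2_mono) (simp add: R'_def)
  finally show ?thesis .
qed

lemma fibre_upper2: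
  assumes "drel L M R" "dgraph L M R f" "dset L M W"
    and "\<And>x y. R x y \<Longrightarrow> f x y \<in> W" "\<And>w. w \<in> W \<Longrightarrow> \<exists>x y. R x y \<and> f x y = w"
    and u: "\<And>w. w \<in> W \<Longrightarrow> dim2 (\<lambda>x y. R x y \<and> f x y = w) \<le> u"
  shows "dim2 R \<le> dim W + u"
proof (cases "\<exists>x y. R x y")
  case False
  then show ?thesis using dim2_empty[of R] by simp
next
  case True
  then have ne: "pset R \<noteq> {}" "singles W \<noteq> {}"
    using assms(4) unfolding pset_def singles_def by auto
  have "dim2 R \<le> dim W + (SUP y\<in>singles W. \<delta> {xs \<in> pset R. [f (xs ! 0) (xs ! 1)] = y})"
    by (rule dim_fibre_upper[OF definable_surjection_pset[OF assms(1-5)] ne])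
  also have "\<dots> \<le> dim W + u"
  proof (rule add_left_mono, rule SUP_least)
    fix y assume "y \<in> singles W"
    then obtain w where w: "y = [w]" "w \<in> W" unfolding singles_def by blast
    then show "\<delta> {xs \<in> pset R. [f (xs ! 0) (xs ! 1)] = y} \<le> u"
      using u unfolding w(1) fibre_pset by simp
  qed
  finally show ?thesis .
qed

lemma dim_image2_le:
  assumes "drel L M R" "dgraph L M R f" "dset L M W" "\<And>w. w \<in> W \<Longrightarrow> \<exists>x y. R x y \<and> f x y = w"
  shows "dim W \<le> dim2 R"
proof (cases "W = {}")
  case False
  from fibre_lower2[OF assms(1-3) False assms(4), of 0] show ?thesis by simp
qed (simp add: dim_empty)

text \<open>Every fibre is a single point and has dimension 0, so the upper fibre inequality has no
  second term.\<close>

lemma dim2_le_if_inj: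
  assumes "drel L M R" "dgraph L M R f" "dset L M W"
    and "\<And>x y. R x y \<Longrightarrow> f x y \<in> W" "\<And>w. w \<in> W \<Longrightarrow> \<exists>x y. R x y \<and> f x y = w"
    and inj: "\<And>x y x' y'. R x y \<Longrightarrow> R x' y' \<Longrightarrow> f x y = f x' y' \<Longrightarrow> x = x' \<and> y = y'"
  shows "dim2 R \<le> dim W"
proof -
  have "dim2 (\<lambda>x y. R x y \<and> f x y = w) \<le> 0" if "w \<in> W" for w
  proof -
    obtain x0 y0 where xy: "R x0 y0" "f x0 y0 = w" using assms(5)[OF \<open>w \<in> W\<close>] by blast
    have "pset (\<lambda>x y. R x y \<and> f x y = w) \<subseteq> {[x0, y0]}"
    proof
      fix xs assume "xs \<in> pset (\<lambda>x y. R x y \<and> f x y = w)"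
      then obtain x y where "xs = [x, y]" "R x y" "f x y = w" unfolding pset_def by blast
      then show "xs \<in> {[x0, y0]}" using inj[OF _ xy(1), of x y] xy(2) by simp
    qed
    then have "finite (pset (\<lambda>x y. R x y \<and> f x y = w))" by (rule finite_subset) simp
    then show ?thesis using dim_finite[OF definable_pset[OF drel_fibre[OF assms(2)]]] by simp
  qed
  from fibre_upper2[OF assms(1-5) this] show ?thesis by simp
qed

lemma dim_image_le:
  assumes X: "dset L M X" and gr: "dfn L M (\<lambda>e. e 0 \<in> X \<and> e 1 = g (e 0))" and W: "dset L M (g ` X)"
  shows "dim (g ` X) \<le> dim X"
proof (cases "X = {}")
  case False
  have "length zs = 2 \<longleftrightarrow> (\<exists>x y. zs = [x, y])" for zs :: "'a list"
    by (auto simp: length_Suc_conv numeral_eq_Suc)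
  then have "{xs @ [g (xs ! 0)] |xs. xs \<in> singles X} = {zs. length zs = 2 \<and> zs ! 0 \<in> X \<and> zs ! 1 = g (zs ! 0)}"
    unfolding singles_def by auto
  moreover have "definable L M 2 {zs. length zs = 2 \<and> zs ! 0 \<in> X \<and> zs ! 1 = g (zs ! 0)}"
    using gr by (rule definable_if_dfn) simp_all
  moreover have "(\<lambda>xs. [g (xs ! 0)]) ` singles X = singles (g ` X)"
    unfolding singles_def by (auto simp: image_image)
  ultimately have surj: "definable_surjection L M 1 1 (singles X) (singles (g ` X)) (\<lambda>xs. [g (xs ! 0)])"
    using X W unfolding definable_surjection_def dset_def by (simp add: numeral_2_eq_2)
  have ne: "singles X \<noteq> {}" "singles (g ` X) \<noteq> {}" using False unfolding singles_def by auto
  have "dim (g ` X) \<le> dim (g ` X) + (INF y\<in>singles (g ` X). \<delta> {x \<in> singles X. [g (x ! 0)] = y})"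
    by simp
  also have "\<dots> \<le> dim X" by (rule dim_fibre_lower[OF surj ne])
  finally show ?thesis .
qed (simp add: dim_empty)

section \<open>Affine images, products and the Ruzsa triangle inequality\<close>

lemma dset_affine:
  assumes "dset L M X"
  shows "dset L M ((\<lambda>x. c * x + t) ` X)"
proof -
  have "dset L M {z. \<exists>x. x \<in> X \<and> z = c * x + t}"
    by (rule dset_Collect, rule dfn_ex[where v = 1], intro dfn_field_intros assms, simp)
  then show ?thesis by (simp add: image_def Bex_def)
qed

text \<open>Images do not raise the dimension; this is applied to the map and to its
  inverse.\<close>

lemma dim_affine:
  assumes "dset L M X" "c \<noteq> 0"
  shows "dim ((\<lambda>x. c * x + t) ` X) = dim X"
proof (rule antisym)
  have *: "dim ((\<lambda>x. c * x + t) ` X) \<le> dim X" if "dset L M X" for X c t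
    by (rule dim_image_le[OF that _ dset_affine[OF that]], intro dfn_field_intros that)
  show "dim ((\<lambda>x. c * x + t) ` X) \<le> dim X" by (rule *[OF assms(1)])
  have "(\<lambda>x. inverse c * x + (- t / c)) ` ((\<lambda>x. c * x + t) ` X) = X"
    using assms(2) by (simp add: image_image field_simps)
  then show "dim X \<le> dim ((\<lambda>x. c * x + t) ` X)"
    using *[OF dset_affine[OF assms(1), of c t], of "inverse c" "- t / c"] by simp
qed

lemma dim_le_if_affine_subset:
  assumes "dset L M X" "dset L M Z" "c \<noteq> 0" "\<And>x. x \<in> X \<Longrightarrow> c * x + t \<in> Z"
  shows "dim X \<le> dim Z"
proof -
  have "dim ((\<lambda>x. c * x + t) ` X) \<le> dim Z"
    using assms by (intro dim_mono dset_affine) auto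
  then show ?thesis using dim_affine[OF assms(1,3)] by simp
qed

lemma drel_times: "dset L M X \<Longrightarrow> dset L M Z \<Longrightarrow> drel L M (\<lambda>x y. x \<in> X \<and> y \<in> Z)"
  unfolding drel_def by (intro dfn_field_intros)

lemma dim2_times:
  assumes "dset L M X" "dset L M Z" "X \<noteq> {}" "Z \<noteq> {}"
  shows "dim2 (\<lambda>x y. x \<in> X \<and> y \<in> Z) = dim X + dim Z"
proof -
  have "list_product (singles X) (singles Z) = pset (\<lambda>x y. x \<in> X \<and> y \<in> Z)"
  proof (rule subset_antisym)
    show "pset (\<lambda>x y. x \<in> X \<and> y \<in> Z) \<subseteq> list_product (singles X) (singles Z)"
    proof
      fix xs assume "xs \<in> pset (\<lambda>x y. x \<in> X \<and> y \<in> Z)"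
      then obtain x y where "xs = [x] @ [y]" "[x] \<in> singles X" "[y] \<in> singles Z"
        unfolding pset_def singles_def by auto
      then show "xs \<in> list_product (singles X) (singles Z)" unfolding list_product_def by blast
    qed
  qed (auto simp: list_product_def singles_def pset_def)
  then show ?thesis
    using dim_product[of 1 "singles X" 1 "singles Z"] assms unfolding dset_def singles_def by simp
qed

lemma dset_lin: "dset L M A \<Longrightarrow> dset L M B \<Longrightarrow> dset L M (lin c A c' B)"
  unfolding lin_def
  by (rule dset_Collect, rule dfn_ex[where v = 1], rule dfn_ex[where v = 2], intro dfn_field_intros) simp_all

lemma dim_lin_scale:
  assumes "dset L M A" "dset L M B" "k \<noteq> 0"
  shows "dim (lin (k * c) A (k * c') B) = dim (lin c A c' B)"
proof -
  have "lin (k * c) A (k * c') B = (\<lambda>x. k * x + 0) ` lin c A c' B"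
  proof (rule subset_antisym)
    show "lin (k * c) A (k * c') B \<subseteq> (\<lambda>x. k * x + 0) ` lin c A c' B"
    proof
      fix z assume "z \<in> lin (k * c) A (k * c') B"
      then obtain a b where "a \<in> A" "b \<in> B" "z = k * c * a + k * c' * b" by (rule linE)
      then have "c * a + c' * b \<in> lin c A c' B" "z = k * (c * a + c' * b) + 0"
        by (auto simp: algebra_simps intro: linI)
      then show "z \<in> (\<lambda>x. k * x + 0) ` lin c A c' B" by (rule rev_image_eqI)
    qed
  qed (auto simp: algebra_simps elim!: linE intro!: linI)
  then show ?thesis using dim_affine[OF dset_lin[OF assms(1,2), of c c'] assms(3), of 0] by simp
qed

lemma dim_le_dim_lin:
  assumes "dset L M A" "dset L M B" "c \<noteq> 0" "B \<noteq> {}"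
  shows "dim A \<le> dim (lin c A c' B)"
proof -
  obtain b where "b \<in> B" using assms(4) by blast
  then show ?thesis
    using assms by (intro dim_le_if_affine_subset[of A _ c "c' * b"] dset_lin) (auto intro: linI)
qed

text \<open>The additive combinatorics rests on this counting principle: if every element of \<open>W\<close> is a
  sum of an element of \<open>U\<close> and one of \<open>V\<close> in many ways, then \<open>W\<close> is small.\<close>

lemma dim_add_le_if_many_sums:
  assumes "dset L M U" "dset L M V" "dset L M W" "W \<noteq> {}"
    and many: "\<And>w. w \<in> W \<Longrightarrow>
      \<exists>T. dset L M T \<and> T \<noteq> {} \<and> T \<subseteq> V \<and> (\<forall>v\<in>T. w - v \<in> U) \<and> l \<le> dim T"
  shows "dim W + l \<le> dim U + dim V"
proof -
  let ?R = "\<lambda>x y. x \<in> U \<and> y \<in> V"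
  have ne: "U \<noteq> {}" "V \<noteq> {}" using assms(4) many by fastforce+
  have gr: "dgraph L M ?R (+)" "dgraph L M ?R (\<lambda>x y. y)"
    unfolding dgraph_def by (intro dfn_field_intros assms)+
  have ex: "\<exists>x y. ?R x y \<and> x + y = w" if "w \<in> W" for w
  proof -
    obtain T where T: "T \<noteq> {}" "T \<subseteq> V" "\<forall>v\<in>T. w - v \<in> U" using many[OF \<open>w \<in> W\<close>] by blast
    then obtain v where "v \<in> T" by blast
    with T have "?R (w - v) v \<and> (w - v) + v = w" by auto
    then show ?thesis by blast
  qed
  have "dim W + l \<le> dim2 ?R"
  proof (rule fibre_lower2[OF drel_times[OF assms(1,2)] gr(1) assms(3,4) ex])
    fix w assume "w \<in> W"
    then obtain T where T: "dset L M T" "T \<subseteq> V" "\<forall>v\<in>T. w - v \<in> U" "l \<le> dim T"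
      using many by blast
    have F: "drel L M (\<lambda>x y. ?R x y \<and> x + y = w)" by (rule drel_fibre[OF gr(1)])
    have G: "dgraph L M (\<lambda>x y. ?R x y \<and> x + y = w) (\<lambda>x y. y)"
      unfolding dgraph_def by (intro dfn_field_intros assms)
    have "dim T \<le> dim2 (\<lambda>x y. ?R x y \<and> x + y = w)"
    proof (rule dim_image2_le[OF F G T(1)])
      fix v assume "v \<in> T"
      then have "(?R (w - v) v \<and> (w - v) + v = w) \<and> v = v" using T by auto
      then show "\<exists>x y. (?R x y \<and> x + y = w) \<and> y = v" by blast
    qed
    then show "l \<le> dim2 (\<lambda>x y. ?R x y \<and> x + y = w)" using T(4) by simp
  qed
  then show ?thesis using dim2_times[OF assms(1,2) ne] by simp
qed

text \<open>Every y in \<open>B\<close> yields the representation ax - cz = (ax - by) + (by - cz).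
  As b is nonzero, distinct y give distinct summands, so the representations have dimension at least
  that of \<open>B\<close>.\<close>

lemma ruzsa_triangle:
  assumes "dset L M A" "dset L M B" "dset L M C" "A \<noteq> {}" "B \<noteq> {}" "C \<noteq> {}" "b \<noteq> 0"
  shows "dim (lin a A (- c) C) + dim B \<le> dim (lin a A (- b) B) + dim (lin b B (- c) C)"
proof (rule dim_add_le_if_many_sums)
  show "lin a A (- c) C \<noteq> {}" using assms(4,6) unfolding lin_def by blast
  fix w assume "w \<in> lin a A (- c) C"
  then obtain x z where xz: "x \<in> A" "z \<in> C" "w = a * x + - c * z" by (rule linE)
  let ?T = "(\<lambda>y. b * y + (- c * z)) ` B"
  have "?T \<subseteq> lin b B (- c) C" using xz by (auto intro: linI)
  moreover have "\<forall>v\<in>?T. w - v \<in> lin a A (- b) B"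
    using xz by (auto intro!: linI[of x A _ B])
  moreover have "dim B \<le> dim ?T" using dim_affine[OF assms(2,7), of "- c * z"] by simp
  ultimately show "\<exists>T. dset L M T \<and> T \<noteq> {} \<and> T \<subseteq> lin b B (- c) C \<and>
      (\<forall>v\<in>T. w - v \<in> lin a A (- b) B) \<and> dim B \<le> dim T"
    using dset_affine[OF assms(2)] assms(5) by blast
qed (intro dset_lin assms)+

end

section \<open>Popular differences and the field of quotients\<close>

lemma lin_commute: "lin c A c' B = lin c' B c A"
  unfolding lin_def by (auto simp: add.commute)

abbreviation diff_quot :: "'a::field set \<Rightarrow> 'a set" where
  "diff_quot Y \<equiv> set_quot (set_diff Y Y) (set_diff Y Y)"

lemma diff_quotI:
  "y0 \<in> Y \<Longrightarrow> y1 \<in> Y \<Longrightarrow> y2 \<in> Y \<Longrightarrow> y3 \<in> Y \<Longrightarrow> y2 \<noteq> y3 \<Longrightarrow> (y0 - y1) / (y2 - y3) \<in> diff_quot Y"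
  unfolding set_quot_def set_diff_def by force

lemma diff_quotE:
  assumes "a \<in> diff_quot Y"
  obtains y0 y1 y2 y3 where "y0 \<in> Y" "y1 \<in> Y" "y2 \<in> Y" "y3 \<in> Y" "y2 \<noteq> y3" "a = (y0 - y1) / (y2 - y3)"
proof -
  from assms obtain u v where "u \<in> set_diff Y Y" "v \<in> set_diff Y Y" "v \<noteq> 0" "a = u / v"
    unfolding set_quot_def by blast
  moreover from this(1,2) obtain y0 y1 y2 y3
    where "y0 \<in> Y" "y1 \<in> Y" "y2 \<in> Y" "y3 \<in> Y" "u = y0 - y1" "v = y2 - y3"
    unfolding set_diff_def by blast
  ultimately show ?thesis using that by auto
qed

text \<open>A definable approximation \<open>B\<close> of \<open>Y\<close> with error e.
  \<open>small\<close> bounds BB - B one dilate at a time, \<open>full\<close> is the lower bound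
  coming from the dimension of \<open>Y\<close>, and \<open>separation\<close> is the compactness
  consequence of a lying outside (Y - Y)/(Y - Y). The ratio 200 leaves room for the errors
  accumulated below.\<close>

locale approx = dim_field L M \<delta>
  for L :: "('f, 'r) language" and M :: "('a::field, 'f, 'r) fo_structure"
    and \<delta> :: "'a list set \<Rightarrow> ennreal" +
  fixes Y B :: "'a set" and d e :: real
  assumes dset_B: "dset L M B" and Y_subset_B: "Y \<subseteq> B"
    and full: "\<And>Z. dset L M Z \<Longrightarrow> Y \<subseteq> Z \<Longrightarrow> ennreal d \<le> dim Z"
    and small: "\<And>c. c \<in> B \<Longrightarrow> dim (lin c B (- 1) B) \<le> ennreal (d + e)"
    and e_pos: "0 < e" and e_small: "200 * e \<le> d"
    and separation: "\<And>a. a \<notin> diff_quot Y \<Longrightarrow>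
      \<exists>Z. dset L M Z \<and> Y \<subseteq> Z \<and> (\<forall>z0\<in>Z. \<forall>z1\<in>Z. \<forall>z2\<in>Z. \<forall>z3\<in>Z. z2 \<noteq> z3 \<longrightarrow> z0 - z1 \<noteq> a * (z2 - z3))"
begin

section \<open>Dilates of \<open>B\<close> that are close to \<open>B\<close>\<close>

lemma d_pos: "0 < d"
  using e_pos e_small by simp

lemma Y_not_subset_singleton: "\<not> Y \<subseteq> {a}"
  using full[OF dset_singleton, of a] d_pos by (auto simp: dim_singleton)

lemma ex_nonzero: "\<exists>y\<in>Y. y \<noteq> 0"
  using Y_not_subset_singleton[of 0] by blast

lemma ex_distinct: "\<exists>y\<in>Y. \<exists>y'\<in>Y. y \<noteq> y'"
  using ex_nonzero Y_not_subset_singleton by blast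

lemma B_nonempty: "B \<noteq> {}"
  using ex_nonzero Y_subset_B by blast

lemma d_le_dim_B: "ennreal d \<le> dim B"
  by (rule full[OF dset_B Y_subset_B])

lemma dim_B_le: "dim B \<le> ennreal (d + e)"
proof -
  obtain y where y: "y \<in> Y" "y \<noteq> 0" using ex_nonzero by blast
  then have "dim B \<le> dim (lin y B (- 1) B)"
    by (intro dim_le_dim_lin dset_B B_nonempty)
  then show ?thesis using small[of y] y Y_subset_B by auto
qed

lemma lin_B_triangle:
  assumes "b \<noteq> 0" "dim (lin a B (- b) B) \<le> ennreal r" "dim (lin b B (- c) B) \<le> ennreal r'" "0 \<le> r" "0 \<le> r'"
  shows "dim (lin a B (- c) B) \<le> ennreal (r + r' - d)"
proof (rule ennreal_add_le_cancel)
  have "dim (lin a B (- c) B) + ennreal d \<le> dim (lin a B (- c) B) + dim B"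
    using d_le_dim_B by (rule add_left_mono)
  also have "\<dots> \<le> dim (lin a B (- b) B) + dim (lin b B (- c) B)"
    by (rule ruzsa_triangle[OF dset_B dset_B dset_B B_nonempty B_nonempty B_nonempty assms(1)])
  also have "\<dots> \<le> ennreal r + ennreal r'" using assms(2,3) by (rule add_mono)
  finally show "dim (lin a B (- c) B) + ennreal d \<le> ennreal (r + r')" using assms(4,5) by simp
qed (use d_pos in simp)

lemma dim_lin_B_swap: "dim (lin c B (- c') B) = dim (lin c' B (- c) B)"
  using dim_lin_scale[OF dset_B dset_B, of "- 1" c "- c'"] lin_commute[of "- c" B c' B] by simp

text \<open>The dilate cB is within Ruzsa distance about 2e of \<open>B\<close>. This allowance
  covers nonzero elements of \<open>Y\<close>, products of two of them, and 1.\<close>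

definition good :: "'a \<Rightarrow> bool" where
  "good c \<longleftrightarrow> c \<noteq> 0 \<and> dim (lin c B (- 1) B) \<le> ennreal (d + 2 * e)"

text \<open>Ruzsa triangle through \<open>B\<close>: the errors 2e and 2e add up.\<close>

lemma good_pair:
  assumes "good c" "good c'"
  shows "dim (lin c B (- c') B) \<le> ennreal (d + 4 * e)"
proof -
  have "dim (lin 1 B (- c') B) \<le> ennreal (d + 2 * e)"
    using assms(2) dim_lin_B_swap[of 1 c'] unfolding good_def by simp
  then have "dim (lin c B (- c') B) \<le> ennreal ((d + 2 * e) + (d + 2 * e) - d)"
    using assms(1) d_pos e_pos unfolding good_def by (intro lin_B_triangle[of 1]) auto
  then show ?thesis by simp
qed

lemma good_Y: "y \<in> Y \<Longrightarrow> y \<noteq> 0 \<Longrightarrow> good y"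
  using order_trans[OF small[of y] ennreal_leI[of "d + e" "d + 2 * e"]] Y_subset_B e_pos
  unfolding good_def by (auto simp del: ennreal_plus)

text \<open>Ruzsa triangle through yB, since yy'B - yB is the y-dilate of y'B - B.\<close>

lemma good_mult:
  assumes "y \<in> Y" "y \<noteq> 0" "y' \<in> Y" "y' \<noteq> 0"
  shows "good (y * y')"
proof -
  have "dim (lin (y * y') B (- y) B) = dim (lin y' B (- 1) B)"
    using dim_lin_scale[OF dset_B dset_B assms(2), of y' "- 1"] by simp
  then have "dim (lin (y * y') B (- 1) B) \<le> ennreal ((d + e) + (d + e) - d)"
    using small[of y] small[of y'] assms Y_subset_B d_pos e_pos
    by (intro lin_B_triangle[of y]) auto
  then show ?thesis using assms unfolding good_def by simp
qed

text \<open>The set yB - yB is bounded by the Ruzsa triangle through \<open>B\<close>; dividing by y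
  gives B - B.\<close>

lemma good_1: "good 1"
proof -
  obtain y where y: "y \<in> Y" "y \<noteq> 0" using ex_nonzero by blast
  have "dim (lin 1 B (- 1) B) \<le> ennreal ((d + e) + (d + e) - d)"
    using small[of y] y Y_subset_B d_pos e_pos dim_lin_B_swap[of 1 y]
      dim_lin_scale[OF dset_B dset_B y(2), of 1 "- 1"]
      lin_B_triangle[of 1 y "d + e" y "d + e"]
    by auto
  then show ?thesis unfolding good_def by simp
qed

section \<open>Popular differences\<close>

definition shift_inter :: "'a \<Rightarrow> 'a set" where
  "shift_inter a = {x. x \<in> B \<and> x - a \<in> B}"

lemma dset_shift_inter: "dset L M (shift_inter a)"
  unfolding shift_inter_def by (rule dset_Collect, intro dfn_field_intros dset_B)

lemma dim_shift_inter_uminus: "dim (shift_inter a) \<le> dim (shift_inter (- a))"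
  by (rule dim_le_if_affine_subset[OF dset_shift_inter dset_shift_inter, of 1 _ "- a"])
    (auto simp: shift_inter_def)

text \<open>Continuity supplies only some definable set between two thresholds, here d - 4e and d -
  3e; \<open>S\<close> is its complement, made symmetric and enlarged by 0. Popularity survives,
  because the intersections for x and -x are translates of each other and the one for 0 is
  \<open>B\<close>.\<close>

lemma ex_popular_differences:
  "\<exists>S. dset L M S \<and> 0 \<in> S \<and> (\<forall>x\<in>S. - x \<in> S) \<and> (\<forall>x\<in>S. ennreal (d - 4 * e) \<le> dim (shift_inter x)) \<and>
    (\<forall>x. x \<notin> S \<longrightarrow> dim (shift_inter x) \<le> ennreal (d - 3 * e))"
proof -
  have "dfn L M (\<lambda>v. v 0 \<in> B \<and> v 0 - v 1 \<in> B)" by (intro dfn_field_intros dset_B)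
  then obtain D where D: "dset L M D"
    "\<And>a. dim (shift_inter a) \<le> ennreal (d - 4 * e) \<Longrightarrow> a \<in> D"
    "\<And>a. a \<in> D \<Longrightarrow> dim (shift_inter a) < ennreal (d - 3 * e)"
    using continuity_family[of "\<lambda>x a. x \<in> B \<and> x - a \<in> B" "d - 4 * e" "d - 3 * e"] e_pos e_small
    unfolding shift_inter_def by auto
  define S where "S = {x. \<not> x \<in> D \<or> \<not> - x \<in> D \<or> x = 0}"
  have "dset L M S" unfolding S_def by (rule dset_Collect, intro dfn_field_intros D)
  moreover have "ennreal (d - 4 * e) \<le> dim (shift_inter x)" if "x \<in> S" for x
  proof -
    have "ennreal (d - 4 * e) \<le> dim (shift_inter x)" if "x \<notin> D" for x
      using D(2)[of x] that by (meson linear)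
    moreover have "dim (shift_inter (- x)) \<le> dim (shift_inter x)"
      using dim_shift_inter_uminus[of "- x"] by simp
    moreover have "ennreal (d - 4 * e) \<le> dim (shift_inter 0)"
    proof -
      have "shift_inter 0 = B" unfolding shift_inter_def by simp
      moreover have "ennreal (d - 4 * e) \<le> ennreal d" using e_pos by (intro ennreal_leI) simp
      ultimately show ?thesis using d_le_dim_B order_trans by metis
    qed
    ultimately show ?thesis using that unfolding S_def by (auto intro: order_trans)
  qed
  moreover have "dim (shift_inter x) \<le> ennreal (d - 3 * e)" if "x \<notin> S" for x
    using that D(3)[of x] unfolding S_def by auto
  moreover have "0 \<in> S" "\<forall>x\<in>S. - x \<in> S" unfolding S_def by auto
  ultimately show ?thesis by blast
qed

end

locale approx_popular = approx L M \<delta> Y B d e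
  for L :: "('f, 'r) language" and M :: "('a::field, 'f, 'r) fo_structure"
    and \<delta> :: "'a list set \<Rightarrow> ennreal" and Y B :: "'a set" and d e :: real +
  fixes S :: "'a set"
  assumes dset_S: "dset L M S" and zero_S: "0 \<in> S" and uminus_S: "\<And>x. x \<in> S \<Longrightarrow> - x \<in> S"
    and popular: "\<And>x. x \<in> S \<Longrightarrow> ennreal (d - 4 * e) \<le> dim (shift_inter x)"
    and unpopular: "\<And>x. x \<notin> S \<Longrightarrow> dim (shift_inter x) \<le> ennreal (d - 3 * e)"
begin

text \<open>For \<open>p \<in> S\<close> write \<open>z + c p - c' b\<^sub>0 = (z - c q) + (c p' - c' b\<^sub>0)\<close> with \<open>p = p' - q\<close>: there are
  many choices of \<open>p'\<close>.\<close>

lemma dim_add_popular: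
  assumes "dset L M Z" "Z \<noteq> {}" "good c" "good c'" "dim (lin 1 Z (- c) B) \<le> ennreal r" "0 \<le> r"
  shows "dim (lin 1 (lin 1 Z c S) (- c') B) \<le> ennreal (r + 8 * e)"
proof -
  let ?W = "lin 1 (lin 1 Z c S) (- c') B"
  have c: "c \<noteq> 0" using assms(3) unfolding good_def by simp
  have pos: "0 < d - 4 * e" using e_pos e_small by simp
  have "dim ?W + ennreal (d - 4 * e) \<le> dim (lin 1 Z (- c) B) + dim (lin c B (- c') B)"
  proof (rule dim_add_le_if_many_sums)
    show "?W \<noteq> {}" using assms(2) zero_S B_nonempty unfolding lin_def by blast
    fix w assume "w \<in> ?W"
    then obtain x b0 where x: "x \<in> lin 1 Z c S" "b0 \<in> B" "w = 1 * x + - c' * b0" by (rule linE)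
    from x(1) obtain z p where z: "z \<in> Z" "p \<in> S" "x = 1 * z + c * p" by (rule linE)
    let ?T = "(\<lambda>y. c * y + (- c' * b0)) ` shift_inter p"
    have "dim ?T = dim (shift_inter p)" by (rule dim_affine[OF dset_shift_inter c])
    then have dT: "ennreal (d - 4 * e) \<le> dim ?T" using popular[OF z(2)] by simp
    then have "?T \<noteq> {}" using pos by (rule nonempty_if_dim_ge)
    moreover have "?T \<subseteq> lin c B (- c') B"
      using x(2) unfolding shift_inter_def by (auto intro: linI)
    moreover have "w - v \<in> lin 1 Z (- c) B" if "v \<in> ?T" for v
    proof -
      obtain y where y: "y - p \<in> B" "v = c * y + - c' * b0" using \<open>v \<in> ?T\<close> unfolding shift_inter_def by blast
      then have "w - v = 1 * z + - c * (y - p)" unfolding x(3) z(3) by (simp add: algebra_simps)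
      then show ?thesis using z(1) y(1) by (rule linI[rotated 2])
    qed
    ultimately show "\<exists>T. dset L M T \<and> T \<noteq> {} \<and> T \<subseteq> lin c B (- c') B \<and>
        (\<forall>v\<in>T. w - v \<in> lin 1 Z (- c) B) \<and> ennreal (d - 4 * e) \<le> dim T"
      using dset_affine[OF dset_shift_inter] dT by blast
  qed (intro dset_lin assms dset_B dset_S)+
  also have "\<dots> \<le> ennreal r + ennreal (d + 4 * e)"
    by (rule add_mono[OF assms(5) good_pair[OF assms(3,4)]])
  also have "\<dots> = ennreal (r + (d + 4 * e))" using assms(6) d_pos e_pos by simp
  \<comment> \<open>The bound d + 4e for cB - c'B set against d - 4e for the representations costs
    8e.\<close>
  finally have "dim ?W \<le> ennreal (r + (d + 4 * e) - (d - 4 * e))"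
    using pos by (intro ennreal_add_le_cancel) auto
  then show ?thesis by (simp add: algebra_simps)
qed

text \<open>\<open>S\<close> is symmetric and contains \<open>0\<close>, so dilating it by \<open>- c\<close> or by \<open>0\<close> is harmless.\<close>

definition sgood :: "'a \<Rightarrow> bool" where
  "sgood c \<longleftrightarrow> c = 0 \<or> good c \<or> good (- c)"

lemma sgood_uminus: "sgood (- c) = sgood c"
  unfolding sgood_def by auto

lemma sgood_Y: "y \<in> Y \<Longrightarrow> sgood y"
  using good_Y unfolding sgood_def by blast

lemma sgood_mult: "y \<in> Y \<Longrightarrow> y' \<in> Y \<Longrightarrow> sgood (y * y')"
  using good_mult unfolding sgood_def by (metis mult_eq_0_iff)

section \<open>Sums of dilates of \<open>S\<close>\<close>

primrec S_sum :: "'a list \<Rightarrow> 'a set" where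
  "S_sum [] = {0}"
| "S_sum (c # cs) = lin 1 (S_sum cs) c S"

lemma dset_S_sum: "dset L M (S_sum cs)"
  by (induction cs) (auto intro: dset_singleton dset_lin dset_S)

lemma S_sum_nonempty: "S_sum cs \<noteq> {}"
  using zero_S by (induction cs) (auto simp: lin_def)

lemma lin_uminus_S: "lin 1 Z (- c) S = lin 1 Z c S"
proof -
  have "lin 1 Z (- c) S \<subseteq> lin 1 Z c S" for c
  proof
    fix z assume "z \<in> lin 1 Z (- c) S"
    then obtain a s where "a \<in> Z" "s \<in> S" "z = 1 * a + - c * s" by (rule linE)
    then show "z \<in> lin 1 Z c S" using uminus_S by (intro linI[of a _ "- s"]) auto
  qed
  from this[of c] this[of "- c"] show ?thesis by simp
qed

text \<open>Each dilate of \<open>S\<close> costs 8e. The term -c'B has to be carried along and c'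
  generalized: to add cS, the induction hypothesis is used with c in place of c', and
  \<open>dim_add_popular\<close> then exchanges -cB for cS - c'B.\<close>

lemma dim_S_sum_B:
  "\<lbrakk>\<forall>c\<in>set cs. sgood c; good c'\<rbrakk> \<Longrightarrow>
    dim (lin 1 (S_sum cs) (- c') B) \<le> ennreal (d + e + 8 * e * length cs)"
proof (induction cs arbitrary: c')
  case Nil
  have "lin 1 {0} (- c') B = (\<lambda>x. (- c') * x + 0) ` B"
    unfolding lin_def by auto
  then have "dim (lin 1 {0} (- c') B) = dim B"
    using Nil dim_affine[OF dset_B, of "- c'" 0] unfolding good_def by simp
  then show ?case using dim_B_le by simp
next
  case (Cons c cs)
  let ?r = "d + e + 8 * e * length cs"
  have good_case: "dim (lin 1 (lin 1 (S_sum cs) c S) (- c') B) \<le> ennreal (?r + 8 * e)" if "good c" for c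
    using Cons.IH[OF _ that] Cons.prems that d_pos e_pos
    by (intro dim_add_popular dset_S_sum S_sum_nonempty) auto
  have len: "?r + 8 * e = d + e + 8 * e * length (c # cs)" by (simp add: algebra_simps)
  consider "c = 0" | "good c" | "good (- c)" using Cons.prems unfolding sgood_def by auto
  then show ?case
  proof cases
    case 1
    have "lin 1 (S_sum cs) 0 S = S_sum cs" using zero_S unfolding lin_def by auto
    moreover have "ennreal ?r \<le> ennreal (?r + 8 * e)" using e_pos by (intro ennreal_leI) simp
    ultimately show ?thesis using Cons 1 unfolding len[symmetric] by (auto intro: order_trans)
  next
    case 2
    then show ?thesis using good_case unfolding len[symmetric] by simp
  next
    case 3
    then show ?thesis using good_case[of "- c"] unfolding len[symmetric] by (simp add: lin_uminus_S)
  qed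
qed

lemma dim_S_sum:
  assumes "\<forall>c\<in>set cs. sgood c"
  shows "dim (S_sum cs) \<le> ennreal (d + e + 8 * e * length cs)"
  using dim_le_dim_lin[OF dset_S_sum dset_B, of 1 cs "- 1"] B_nonempty dim_S_sum_B[OF assms good_1]
  by (auto intro: order_trans)

lemma sum_list_mult_mem_S_sum: "s \<in> S \<Longrightarrow> sum_list cs * s \<in> S_sum cs"
  by (induction cs) (auto intro!: linI simp: algebra_simps)

lemma add_mem_S_sum: "a \<in> S_sum as \<Longrightarrow> b \<in> S_sum bs \<Longrightarrow> a + b \<in> S_sum (as @ bs)"
proof (induction as arbitrary: a)
  case (Cons c as)
  from Cons.prems(1) obtain a' s where "a' \<in> S_sum as" "s \<in> S" "a = 1 * a' + c * s"
    by (auto elim: linE)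
  then show ?case using Cons.IH[of a'] Cons.prems(2)
    by (auto intro!: linI[of "a' + b" _ s] simp: algebra_simps)
qed simp

text \<open>Scaling by v = \<open>sum_list vs\<close> turns S + (u/v)S into vS + uS, which lies in
  the sum of the dilates by all listed coefficients. Twelve terms at 8e each, plus the initial e,
  make 97e.\<close>

lemma dim_dilate_sum:
  assumes "\<forall>c\<in>set us. sgood c" "\<forall>c\<in>set vs. sgood c" "sum_list vs \<noteq> 0" "length us + length vs \<le> 12"
  shows "dim (lin 1 S (sum_list us / sum_list vs) S) \<le> ennreal (d + 97 * e)"
proof -
  have "lin (sum_list vs) S (sum_list us) S \<subseteq> S_sum (vs @ us)"
    by (auto elim!: linE intro!: add_mem_S_sum sum_list_mult_mem_S_sum)
  then have "dim (lin (sum_list vs) S (sum_list us) S) \<le> dim (S_sum (vs @ us))"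
    by (intro dim_mono dset_lin dset_S dset_S_sum)
  also have "\<dots> \<le> ennreal (d + e + 8 * e * length (vs @ us))"
    using assms(1,2) by (intro dim_S_sum) auto
  also have "\<dots> \<le> ennreal (d + 97 * e)"
  proof (rule ennreal_leI)
    have "real (length (vs @ us)) \<le> 12" using assms(4) by simp
    then have "e * real (length (vs @ us)) \<le> e * 12" using e_pos by (intro mult_left_mono) auto
    then show "d + e + 8 * e * length (vs @ us) \<le> d + 97 * e" by simp
  qed
  also have "dim (lin (sum_list vs) S (sum_list us) S) = dim (lin 1 S (sum_list us / sum_list vs) S)"
    using dim_lin_scale[OF dset_S dset_S assms(3), of 1 "sum_list us / sum_list vs"] assms(3) by simp
  finally show ?thesis .
qed

section \<open>Lower bounds from popular pairs\<close>

lemma finite_dim_subset: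
  assumes "dset L M Z" "Y \<subseteq> Z" "Z \<subseteq> B"
  obtains r where "dim Z = ennreal r" "d \<le> r" "r \<le> d + e"
proof -
  have "dim Z \<le> ennreal (d + e)"
    using dim_mono[OF assms(1) dset_B assms(3)] dim_B_le by (rule order_trans)
  moreover from this obtain r where r: "dim Z = ennreal r" "0 \<le> r"
    by (cases "dim Z") (auto simp: top_unique)
  moreover have "ennreal d \<le> dim Z" by (rule full[OF assms(1,2)])
  ultimately have "d \<le> r" "r \<le> d + e"
    using d_pos e_pos by (auto simp: ennreal_le_iff simp del: ennreal_plus)
  then show ?thesis using that r(1) by blast
qed

text \<open>Project pairs to their difference. The differences lie in B - B, of dimension at most d
  + 2e, and an unpopular one has a fibre of dimension at most d - 3e.\<close>

lemma dim2_unpopular_pairs: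
  assumes "dset L M Z" "Y \<subseteq> Z" "Z \<subseteq> B"
  shows "dim2 (\<lambda>x y. x \<in> Z \<and> y \<in> Z \<and> \<not> x - y \<in> S) \<le> ennreal (2 * d - e)"
proof -
  let ?R = "\<lambda>x y. x \<in> Z \<and> y \<in> Z \<and> \<not> x - y \<in> S"
  define W where "W = {w. \<exists>x. \<exists>y. (x \<in> Z \<and> y \<in> Z \<and> \<not> x - y \<in> S) \<and> x - y = w}"
  have R: "drel L M ?R" unfolding drel_def by (intro dfn_field_intros assms dset_S)
  have gr: "dgraph L M ?R (-)" unfolding dgraph_def by (intro dfn_field_intros assms dset_S)
  have W: "dset L M W"
    unfolding W_def
    by (rule dset_Collect, rule dfn_ex[where v = 1], rule dfn_ex[where v = 2],
        intro dfn_field_intros assms dset_S) simp_all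
  have "dim2 ?R \<le> dim W + ennreal (d - 3 * e)"
  proof (rule fibre_upper2[OF R gr W])
    fix w assume "w \<in> W"
    then have w: "w \<notin> S" unfolding W_def by auto
    let ?F = "\<lambda>x y. ?R x y \<and> x - y = w"
    define V where "V = {x. x \<in> Z \<and> x - w \<in> Z}"
    have V: "dset L M V" unfolding V_def by (rule dset_Collect, intro dfn_field_intros assms)
    have G: "dgraph L M ?F (\<lambda>x y. x)" unfolding dgraph_def by (intro dfn_field_intros assms dset_S)
    have "dim2 ?F \<le> dim V"
    proof (rule dim2_le_if_inj[OF drel_fibre[OF gr] G V])
      fix v assume "v \<in> V"
      then have "?F v (v - w) \<and> v = v" using w unfolding V_def by simp
      then show "\<exists>x y. ?F x y \<and> x = v" by blast
    qed (auto simp: V_def)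
    also have "\<dots> \<le> dim (shift_inter w)"
      using assms(3) by (intro dim_mono V dset_shift_inter) (auto simp: V_def shift_inter_def)
    also have "\<dots> \<le> ennreal (d - 3 * e)" by (rule unpopular[OF w])
    finally show "dim2 ?F \<le> ennreal (d - 3 * e)" .
  qed (auto simp: W_def)
  also have "dim W \<le> dim (lin 1 B (- 1) B)"
  proof (intro dim_mono W dset_lin dset_B subsetI)
    fix w assume "w \<in> W"
    then obtain x y where "x \<in> Z" "y \<in> Z" "w = x - y" unfolding W_def by blast
    then show "w \<in> lin 1 B (- 1) B" using assms(3) by (intro linI[of x _ y]) auto
  qed
  also have "\<dots> \<le> ennreal (d + 2 * e)" using good_1 unfolding good_def by simp
  also have "ennreal (d + 2 * e) + ennreal (d - 3 * e) = ennreal (2 * d - e)"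
    using d_pos e_pos e_small by (simp flip: ennreal_plus)
  finally show ?thesis by (simp add: add_right_mono)
qed

text \<open>Most pairs in \<open>Z\<close> have a popular difference, so a translate of \<open>S\<close> meets \<open>Z\<close> in full dimension.\<close>

lemma ex_large_translate:
  assumes "dset L M Z" "Y \<subseteq> Z" "Z \<subseteq> B"
  obtains b where "b \<in> Z" "ennreal (d - e) \<le> dim {x. x \<in> S \<and> x + b \<in> Z}"
proof (rule ccontr)
  assume "\<not> thesis"
  then have few: "dim {x. x \<in> S \<and> x + b \<in> Z} \<le> ennreal (d - e)" if "b \<in> Z" for b
    using that \<open>\<And>b. b \<in> Z \<Longrightarrow> ennreal (d - e) \<le> dim {x. x \<in> S \<and> x + b \<in> Z} \<Longrightarrow> thesis\<close>
    by (meson linear)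
  let ?P = "\<lambda>x y. x \<in> Z \<and> y \<in> Z \<and> x - y \<in> S"
  let ?N = "\<lambda>x y. x \<in> Z \<and> y \<in> Z \<and> \<not> x - y \<in> S"
  obtain r where r: "dim Z = ennreal r" "d \<le> r" "r \<le> d + e" by (rule finite_dim_subset[OF assms])
  have ne: "Z \<noteq> {}" using assms(2) ex_nonzero by blast
  have P: "drel L M ?P" and N: "drel L M ?N"
    unfolding drel_def by (intro dfn_field_intros assms dset_S)+
  have "pset (\<lambda>x y. x \<in> Z \<and> y \<in> Z) = pset ?P \<union> pset ?N" unfolding pset_def by auto
  then have "max (dim2 ?P) (dim2 ?N) = dim Z + dim Z"
    using dim_union[OF definable_pset[OF P] definable_pset[OF N]] dim2_times[OF assms(1,1) ne ne] by simp
  also have "\<dots> = ennreal (2 * r)" using r d_pos by (simp flip: ennreal_plus)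
  finally have mx: "max (dim2 ?P) (dim2 ?N) = ennreal (2 * r)" .
  \<comment> \<open>The dimension of a union is a maximum, and unpopular pairs fall short of 2r, so
    the popular pairs have dimension exactly 2r.\<close>
  have "dim2 ?N < ennreal (2 * r)"
    using r(2) e_pos e_small by (intro le_less_trans[OF dim2_unpopular_pairs[OF assms]]) (auto simp: ennreal_less_iff)
  then have P2: "dim2 ?P = ennreal (2 * r)" using mx by (auto simp: max_def split: if_splits)
  define W where "W = {y. y \<in> Z \<and> (\<exists>x. x \<in> Z \<and> x - y \<in> S)}"
  have W: "dset L M W"
    unfolding W_def
    by (rule dset_Collect, rule dfn_conj, intro dfn_field_intros assms, rule dfn_ex[where v = 1],
        intro dfn_field_intros assms dset_S) simp
  have gr: "dgraph L M ?P (\<lambda>x y. y)" unfolding dgraph_def by (intro dfn_field_intros assms dset_S)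
  \<comment> \<open>With every slice of dimension at most d - e, the popular pairs would have
    dimension at most r + d - e, which is less than 2r.\<close>
  have "dim2 ?P \<le> dim W + ennreal (d - e)"
  proof (rule fibre_upper2[OF P gr W])
    fix b assume "b \<in> W"
    then have b: "b \<in> Z" unfolding W_def by simp
    let ?F = "\<lambda>x y. ?P x y \<and> y = b"
    define V where "V = {x. x \<in> S \<and> x + b \<in> Z}"
    have V: "dset L M V" unfolding V_def by (rule dset_Collect, intro dfn_field_intros assms dset_S)
    have G: "dgraph L M ?F (\<lambda>x y. x - b)" unfolding dgraph_def by (intro dfn_field_intros assms dset_S)
    have "dim2 ?F \<le> dim V"
    proof (rule dim2_le_if_inj[OF drel_fibre[OF gr] G V])
      fix v assume "v \<in> V"
      then have "?F (v + b) b \<and> v + b - b = v" using b unfolding V_def by simp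
      then show "\<exists>x y. ?F x y \<and> x - b = v" by blast
    qed (auto simp: V_def)
    then show "dim2 ?F \<le> ennreal (d - e)" using few[OF b] unfolding V_def by simp
  qed (auto simp: W_def)
  also have "\<dots> \<le> ennreal r + ennreal (d - e)"
    using dim_mono[OF W assms(1)] r(1) by (intro add_right_mono) (auto simp: W_def)
  also have "\<dots> = ennreal (r + (d - e))" using r d_pos e_pos e_small by (simp flip: ennreal_plus)
  finally show False using P2 r d_pos e_pos e_small by (simp add: ennreal_le_iff del: ennreal_plus)
qed

lemma dim_S_ge: "ennreal (d - e) \<le> dim S"
proof -
  obtain b where b: "ennreal (d - e) \<le> dim {x. x \<in> S \<and> x + b \<in> B}"
    using ex_large_translate[OF dset_B Y_subset_B order_refl] by blast
  have "dset L M {x. x \<in> S \<and> x + b \<in> B}"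
    by (rule dset_Collect, intro dfn_field_intros dset_S dset_B)
  then have "dim {x. x \<in> S \<and> x + b \<in> B} \<le> dim S" by (rule dim_mono[OF _ dset_S]) blast
  then show ?thesis using b by (rule order_trans[rotated])
qed

text \<open>\<open>separation\<close> gives a definable superset of \<open>Y\<close> in which z0 -
  z1 = a(z2 - z3) forces z2 = z3. A large part \<open>C\<close> of \<open>S\<close> lies in a
  translate of it, with the same differences, so (x, y) to x + ay is injective on C x C.\<close>

lemma dim_dilate_ge:
  assumes "a \<notin> diff_quot Y"
  shows "ennreal (2 * d - 2 * e) \<le> dim (lin 1 S a S)"
proof -
  obtain Z0 where Z0: "dset L M Z0" "Y \<subseteq> Z0"
    "\<forall>z0\<in>Z0. \<forall>z1\<in>Z0. \<forall>z2\<in>Z0. \<forall>z3\<in>Z0. z2 \<noteq> z3 \<longrightarrow> z0 - z1 \<noteq> a * (z2 - z3)"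
    using separation[OF assms] by blast
  define Z where "Z = {z. z \<in> Z0 \<and> z \<in> B}"
  have Z: "dset L M Z" unfolding Z_def by (rule dset_Collect, intro dfn_field_intros Z0 dset_B)
  obtain b where b: "b \<in> Z" "ennreal (d - e) \<le> dim {x. x \<in> S \<and> x + b \<in> Z}"
    using ex_large_translate[OF Z] Z0(2) Y_subset_B unfolding Z_def by blast
  define C where "C = {x. x \<in> S \<and> x + b \<in> Z}"
  have C: "dset L M C" unfolding C_def by (rule dset_Collect, intro dfn_field_intros Z dset_S)
  have dC: "ennreal (d - e) \<le> dim C" using b unfolding C_def by simp
  have ne: "C \<noteq> {}"
    using e_pos e_small by (intro nonempty_if_dim_ge[OF dC]) simp
  let ?R = "\<lambda>x y. x \<in> C \<and> y \<in> C"
  have G: "dgraph L M ?R (\<lambda>x y. 1 * x + a * y)" unfolding dgraph_def by (intro dfn_field_intros C)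
  have "dim2 ?R \<le> dim (lin 1 C a C)"
  proof (rule dim2_le_if_inj[OF drel_times[OF C C] G dset_lin[OF C C, of 1 a]])
    fix x y x' y' assume *: "?R x y" "?R x' y'" "1 * x + a * y = 1 * x' + a * y'"
    then have "(x + b) - (x' + b) = a * ((y' + b) - (y + b))" by (simp add: algebra_simps)
    moreover have "x + b \<in> Z0" "x' + b \<in> Z0" "y + b \<in> Z0" "y' + b \<in> Z0"
      using * unfolding C_def Z_def by auto
    ultimately have "y' + b = y + b" using Z0(3) by blast
    then show "x = x' \<and> y = y'" using * by simp
  qed (auto intro: linI elim: linE simp: lin_def)
  also have "\<dots> \<le> dim (lin 1 S a S)"
    by (intro dim_mono dset_lin C dset_S lin_mono) (auto simp: C_def)
  finally have "dim C + dim C \<le> dim (lin 1 S a S)" using dim2_times[OF C C ne ne] by simp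
  moreover have "ennreal (d - e) + ennreal (d - e) \<le> dim C + dim C" using dC dC by (rule add_mono)
  moreover have "ennreal (d - e) + ennreal (d - e) = ennreal (2 * d - 2 * e)"
    using e_pos e_small by (simp flip: ennreal_plus)
  ultimately show ?thesis by (metis order_trans)
qed

section \<open>The dimension gap makes (Y - Y)/(Y - Y) a definable field\<close>

lemma dilate_gap: "d + 97 * e < 2 * d - 2 * e"
  using e_pos e_small by simp

lemma mem_diff_quot_if_dim_less: "dim (lin 1 S a S) < ennreal (2 * d - 2 * e) \<Longrightarrow> a \<in> diff_quot Y"
  using dim_dilate_ge[of a] by (auto simp: not_le[symmetric])

text \<open>By the gap, a small S + aS already forces a into (Y - Y)/(Y - Y). This is how closure
  under the field operations is obtained.\<close>

lemma quot_mem_diff_quot: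
  assumes "\<forall>c\<in>set us. sgood c" "\<forall>c\<in>set vs. sgood c" "sum_list vs \<noteq> 0" "length us + length vs \<le> 12"
  shows "sum_list us / sum_list vs \<in> diff_quot Y"
proof (rule mem_diff_quot_if_dim_less)
  have "ennreal (d + 97 * e) < ennreal (2 * d - 2 * e)"
    using dilate_gap d_pos e_pos by (simp add: ennreal_less_iff del: ennreal_plus)
  then show "dim (lin 1 S (sum_list us / sum_list vs) S) < ennreal (2 * d - 2 * e)"
    using dim_dilate_sum[OF assms] by (rule le_less_trans[rotated])
qed

lemma dim_dilate_le:
  assumes "a \<in> diff_quot Y"
  shows "dim (lin 1 S a S) \<le> ennreal (d + 97 * e)"
proof -
  from assms obtain y0 y1 y2 y3 where y: "y0 \<in> Y" "y1 \<in> Y" "y2 \<in> Y" "y3 \<in> Y" "y2 \<noteq> y3"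
    "a = (y0 - y1) / (y2 - y3)" by (rule diff_quotE)
  then show ?thesis
    using dim_dilate_sum[of "[y0, - y1]" "[y2, - y3]"] by (simp add: sgood_Y sgood_uminus)
qed

text \<open>Continuity, applied with the two ends of the gap as thresholds, leaves no freedom: the
  separating set is exactly (Y - Y)/(Y - Y).\<close>

lemma dset_diff_quot: "dset L M (diff_quot Y)"
proof -
  have "dfn L M (\<lambda>v. \<exists>x. \<exists>y. x \<in> S \<and> y \<in> S \<and> v 0 = 1 * x + v 1 * y)"
    by (rule dfn_ex[where v = 2], rule dfn_ex[where v = 3], intro dfn_field_intros dset_S) simp_all
  from continuity_family[of "\<lambda>z a. \<exists>x. \<exists>y. x \<in> S \<and> y \<in> S \<and> z = 1 * x + a * y", OF this _ dilate_gap]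
  obtain D where D: "dset L M D" "\<And>a. dim (lin 1 S a S) \<le> ennreal (d + 97 * e) \<Longrightarrow> a \<in> D"
    "\<And>a. a \<in> D \<Longrightarrow> dim (lin 1 S a S) < ennreal (2 * d - 2 * e)"
    using d_pos e_pos unfolding lin_def by auto
  have "D = diff_quot Y"
    using D(2,3) dim_dilate_le mem_diff_quot_if_dim_less by blast
  then show ?thesis using D(1) by simp
qed

lemma diff_quot_subfield: "is_subfield (diff_quot Y)"
proof -
  obtain y y' where y: "y \<in> Y" "y' \<in> Y" "y \<noteq> y'" using ex_distinct by blast
  have "0 \<in> diff_quot Y" "1 \<in> diff_quot Y"
    using diff_quotI[OF y(1,1,1,2,3)] diff_quotI[OF y(1,2,1,2,3)] y(3) by auto
  moreover have "- a \<in> diff_quot Y \<and> (a \<noteq> 0 \<longrightarrow> inverse a \<in> diff_quot Y)" if "a \<in> diff_quot Y" for a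
  proof -
    from that obtain y0 y1 y2 y3 where y: "y0 \<in> Y" "y1 \<in> Y" "y2 \<in> Y" "y3 \<in> Y" "y2 \<noteq> y3"
      "a = (y0 - y1) / (y2 - y3)" by (rule diff_quotE)
    have "- a = (y1 - y0) / (y2 - y3)" using y(5,6) by (simp add: field_simps)
    moreover have "inverse a = (y2 - y3) / (y0 - y1)" using y(6) by simp
    moreover have "y0 \<noteq> y1" if "a \<noteq> 0" using that y(6) by auto
    ultimately show ?thesis using y diff_quotI by metis
  qed
  moreover have "a + b \<in> diff_quot Y \<and> a * b \<in> diff_quot Y" if ab: "a \<in> diff_quot Y" "b \<in> diff_quot Y" for a b
  proof -
    from ab(1) obtain y0 y1 y2 y3 where y: "y0 \<in> Y" "y1 \<in> Y" "y2 \<in> Y" "y3 \<in> Y" "y2 \<noteq> y3"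
      "a = (y0 - y1) / (y2 - y3)" by (rule diff_quotE)
    from ab(2) obtain x0 x1 x2 x3 where x: "x0 \<in> Y" "x1 \<in> Y" "x2 \<in> Y" "x3 \<in> Y" "x2 \<noteq> x3"
      "b = (x0 - x1) / (x2 - x3)" by (rule diff_quotE)
    \<comment> \<open>The expansion of (u0 - u1)(v0 - v1) into four signed products. Over a common
      denominator a + b takes 8 + 4 terms, which is where the bound 12 comes from; a * b takes 4 +
      4.\<close>
    let ?P = "\<lambda>u0 u1 v0 v1. [u0 * v0, - (u0 * v1), - (u1 * v0), u1 * v1]"
    have sum: "sum_list (?P u0 u1 v0 v1) = (u0 - u1) * (v0 - v1)" for u0 u1 v0 v1 :: 'a
      by (simp add: algebra_simps)
    have good: "\<forall>c\<in>set (?P u0 u1 v0 v1). sgood c"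
      if "u0 \<in> Y" "u1 \<in> Y" "v0 \<in> Y" "v1 \<in> Y" for u0 u1 v0 v1
      using that by (simp add: sgood_mult sgood_uminus)
    let ?v = "?P y2 y3 x2 x3"
    have v: "sum_list ?v \<noteq> 0" unfolding sum using x(5) y(5) by simp
    have "a + b = sum_list (?P y0 y1 x2 x3 @ ?P x0 x1 y2 y3) / sum_list ?v"
      unfolding sum_list_append sum x(6) y(6) using x(5) y(5) by (simp add: field_simps)
    moreover have "a * b = sum_list (?P y0 y1 x0 x1) / sum_list ?v"
      unfolding sum x(6) y(6) by simp
    ultimately show ?thesis
      using quot_mem_diff_quot[of "?P y0 y1 x2 x3 @ ?P x0 x1 y2 y3" ?v, OF _ _ v]
        quot_mem_diff_quot[of "?P y0 y1 x0 x1" ?v, OF _ _ v] good x(1-4) y(1-4)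
      by (simp only: set_append ball_Un) simp
  qed
  ultimately show ?thesis unfolding is_subfield_def by blast
qed

section \<open>The dimension of the field\<close>

lemma d_le_dim_diff_quot: "ennreal d \<le> dim (diff_quot Y)"
proof -
  obtain y y' where y: "y \<in> Y" "y' \<in> Y" "y \<noteq> y'" using ex_distinct by blast
  have "Y \<subseteq> (\<lambda>k. (y - y') * k + y') ` diff_quot Y"
  proof
    fix z assume "z \<in> Y"
    then have "(z - y') / (y - y') \<in> diff_quot Y" using y by (intro diff_quotI)
    moreover have "z = (y - y') * ((z - y') / (y - y')) + y'" using y by simp
    ultimately show "z \<in> (\<lambda>k. (y - y') * k + y') ` diff_quot Y" by (rule rev_image_eqI)
  qed
  from full[OF dset_affine[OF dset_diff_quot] this] show ?thesis
    using dim_affine[OF dset_diff_quot] y(3) by simp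
qed

text \<open>For \<open>k\<close> in the field the map \<open>(s, s') \<mapsto> s + k s'\<close> on \<open>S \<times> S\<close> has small image, hence a large
  fibre, and differences of elements of the fibre represent \<open>k\<close> as a quotient in many ways.\<close>

lemma many_quotients:
  assumes "k \<in> diff_quot Y" "k \<noteq> 0"
  shows "ennreal (d - 100 * e) \<le> dim {x. x \<in> lin 1 S 1 S \<and> (\<exists>y. y \<in> lin 1 S 1 S \<and> x = k * y)}"
proof -
  let ?V = "lin 1 S 1 S"
  let ?R = "\<lambda>x y. x \<in> S \<and> y \<in> S"
  define N where "N = {x. x \<in> ?V \<and> (\<exists>y. y \<in> ?V \<and> x = k * y)}"
  have V: "dset L M ?V" by (rule dset_lin[OF dset_S dset_S])
  have N: "dset L M N"
    unfolding N_def
    by (rule dset_Collect, rule dfn_conj, intro dfn_field_intros V, rule dfn_ex[where v = 1],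
        intro dfn_field_intros V) simp
  have ne: "S \<noteq> {}" using zero_S by blast
  have gr: "dgraph L M ?R (\<lambda>x y. 1 * x + k * y)" unfolding dgraph_def by (intro dfn_field_intros dset_S)
  \<comment> \<open>Otherwise the upper fibre inequality would give 2(d - e) <= (d + 97e) + (d -
    100e).\<close>
  have "\<exists>w\<in>lin 1 S k S. ennreal (d - 100 * e) < dim2 (\<lambda>x y. ?R x y \<and> 1 * x + k * y = w)"
  proof (rule ccontr)
    assume "\<not> ?thesis"
    then have "dim2 (\<lambda>x y. ?R x y \<and> 1 * x + k * y = w) \<le> ennreal (d - 100 * e)" if "w \<in> lin 1 S k S" for w
      using that by (meson not_le)
    then have "dim2 ?R \<le> dim (lin 1 S k S) + ennreal (d - 100 * e)"
      by (intro fibre_upper2[OF drel_times[OF dset_S dset_S] gr dset_lin[OF dset_S dset_S]])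
        (auto simp: lin_def)
    also have "\<dots> \<le> ennreal (d + 97 * e) + ennreal (d - 100 * e)"
      by (rule add_right_mono[OF dim_dilate_le[OF assms(1)]])
    finally have "dim S + dim S \<le> ennreal (d + 97 * e) + ennreal (d - 100 * e)"
      using dim2_times[OF dset_S dset_S ne ne] by simp
    moreover have "ennreal (d - e) + ennreal (d - e) \<le> dim S + dim S"
      using dim_S_ge dim_S_ge by (rule add_mono)
    ultimately have "ennreal (d - e) + ennreal (d - e) \<le> ennreal (d + 97 * e) + ennreal (d - 100 * e)"
      by (rule order_trans[rotated])
    then show False using e_pos e_small by (simp add: ennreal_le_iff flip: ennreal_plus)
  qed
  then obtain w where w: "ennreal (d - 100 * e) < dim2 (\<lambda>x y. ?R x y \<and> 1 * x + k * y = w)" by blast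
  let ?F = "\<lambda>x y. ?R x y \<and> 1 * x + k * y = w"
  have "\<exists>s t. ?F s t"
  proof (rule ccontr)
    assume "\<not> ?thesis"
    then have "dim2 ?F = 0" by (intro dim2_empty) blast
    then show False using w by simp
  qed
  then obtain s t where st: "s \<in> S" "t \<in> S" "s + k * t = w" by auto
  \<comment> \<open>Subtracting the fixed solution (s, t) from any solution (x, y) gives x - s = k(t
    - y), with x - s and t - y in S + S by symmetry of \<open>S\<close>.\<close>
  define N' where "N' = {z. \<exists>x. \<exists>y. ?F x y \<and> x - s = z}"
  have N': "dset L M N'"
    unfolding N'_def
    by (rule dset_Collect, rule dfn_ex[where v = 1], rule dfn_ex[where v = 2],
        intro dfn_field_intros dset_S) simp_all
  have gr2: "dgraph L M ?F (\<lambda>x y. x - s)" unfolding dgraph_def by (intro dfn_field_intros dset_S)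
  have "dim2 ?F \<le> dim N'"
  proof (rule dim2_le_if_inj[OF drel_fibre[OF gr] gr2 N'])
    fix x y x' y' assume "?F x y" "?F x' y'" "x - s = x' - s"
    then show "x = x' \<and> y = y'" using assms(2) by auto
  qed (auto simp: N'_def)
  also have "\<dots> \<le> dim N"
  proof (rule dim_mono[OF N' N], rule subsetI)
    fix z assume "z \<in> N'"
    then obtain x y where xy: "x \<in> S" "y \<in> S" "x + k * y = w" "z = x - s" unfolding N'_def by auto
    have "z \<in> ?V" using xy st uminus_S by (intro linI[of x _ "- s"]) auto
    moreover have "t - y \<in> ?V" using xy st uminus_S by (intro linI[of t _ "- y"]) auto
    moreover have "x + k * y = s + k * t" using xy(3) st(3) by simp
    then have "z = k * (t - y)" unfolding xy(4) by (simp add: algebra_simps)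
    ultimately show "z \<in> N" unfolding N_def by blast
  qed
  finally show ?thesis using w unfolding N_def by simp
qed

text \<open>Map pairs from S + S to their quotients. Every nonzero k in the field has a fibre of
  dimension at least d - 100e, and S + S has dimension at most d + 17e, so the field has dimension
  at most 2(d + 17e) - (d - 100e).\<close>

lemma dim_diff_quot_le: "dim (diff_quot Y) \<le> ennreal (d + 134 * e)"
proof -
  let ?V = "lin 1 S 1 S" and ?K = "diff_quot Y - {0}"
  let ?R = "\<lambda>u v. u \<in> ?V \<and> v \<in> ?V - {0}"
  have V: "dset L M ?V" "dset L M (?V - {0})"
    by (intro dset_Diff_singleton dset_lin dset_S)+
  have K: "dset L M ?K" by (intro dset_Diff_singleton dset_diff_quot)
  have R: "drel L M ?R" by (rule drel_times[OF V])
  have gr: "dgraph L M ?R (/)"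
  proof -
    have "dfn L M (\<lambda>v. (v 0 \<in> ?V \<and> v 1 \<in> ?V - {0}) \<and> v 2 * v 1 = v 0)"
      by (intro dfn_field_intros V)
    moreover have "((x \<in> ?V \<and> y \<in> ?V - {0}) \<and> z * y = x) \<longleftrightarrow> ((x \<in> ?V \<and> y \<in> ?V - {0}) \<and> z = x / y)" for x y z
      by (auto simp: field_simps)
    ultimately show ?thesis unfolding dgraph_def by simp
  qed
  have large: "ennreal (d - 100 * e) \<le> dim2 (\<lambda>u v. ?R u v \<and> u / v = k)" if "k \<in> ?K" for k
  proof -
    define N where "N = {x. x \<in> ?V \<and> (\<exists>y. y \<in> ?V \<and> x = k * y)}"
    have N: "dset L M N"
      unfolding N_def
      by (rule dset_Collect, rule dfn_conj, intro dfn_field_intros V, rule dfn_ex[where v = 1],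
          intro dfn_field_intros V) simp
    have gr2: "dgraph L M (\<lambda>u v. ?R u v \<and> u / v = k) (\<lambda>u v. u)"
    proof -
      have "dfn L M (\<lambda>v. ((v 0 \<in> ?V \<and> v 1 \<in> ?V - {0}) \<and> v 0 / v 1 = k) \<and> v 2 = v 0)"
        by (rule dfn_conj, rule drel_fibre[OF gr, unfolded drel_def], intro dfn_field_intros)
      then show ?thesis unfolding dgraph_def .
    qed
    \<comment> \<open>Dropping 0 costs no dimension and makes the denominator y in x = ky
      nonzero.\<close>
    have "ennreal (d - 100 * e) \<le> dim (N - {0})"
      using many_quotients[of k] that dim_Diff_singleton[OF N] unfolding N_def by simp
    also have "\<dots> \<le> dim2 (\<lambda>u v. ?R u v \<and> u / v = k)"
    proof (rule dim_image2_le[OF drel_fibre[OF gr] gr2 dset_Diff_singleton[OF N]])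
      fix x assume "x \<in> N - {0}"
      then obtain y where "x \<in> ?V" "y \<in> ?V" "x = k * y" "x \<noteq> 0" unfolding N_def by blast
      then have "(?R x y \<and> x / y = k) \<and> x = x" by auto
      then show "\<exists>u v. (?R u v \<and> u / v = k) \<and> u = x" by blast
    qed
    finally show ?thesis .
  qed
  have pos: "0 < ennreal (d - 100 * e)" using e_pos e_small by simp
  have ex: "\<exists>u v. ?R u v \<and> u / v = k" if "k \<in> ?K" for k
  proof (rule ccontr)
    assume "\<not> ?thesis"
    then have "dim2 (\<lambda>u v. ?R u v \<and> u / v = k) = 0" by (intro dim2_empty) blast
    then show False using large[OF that] pos by simp
  qed
  have neK: "?K \<noteq> {}"
    using nonempty_if_dim_ge[OF _ d_pos, of ?K] d_le_dim_diff_quot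
      dim_Diff_singleton[OF dset_diff_quot] by simp
  have neV: "?V \<noteq> {}" "?V - {0} \<noteq> {}" using ex neK by blast+
  have "?V = S_sum [1, 1]" by (auto simp: lin_def)
  then have dV: "dim ?V \<le> ennreal (d + 17 * e)"
    using dim_S_sum[of "[1, 1]"] good_1 unfolding sgood_def by (simp add: add.commute)
  have "dim ?K + ennreal (d - 100 * e) \<le> dim2 ?R"
    by (rule fibre_lower2[OF R gr K neK ex large])
  also have "\<dots> = dim ?V + dim ?V"
    using dim2_times[OF V neV] dim_Diff_singleton[OF V(1)] by simp
  also have "\<dots> \<le> ennreal (d + 17 * e) + ennreal (d + 17 * e)" using dV dV by (rule add_mono)
  also have "\<dots> = ennreal (2 * d + 34 * e)" using d_pos e_pos by (simp flip: ennreal_plus)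
  finally have "dim ?K \<le> ennreal (2 * d + 34 * e - (d - 100 * e))"
    using e_pos e_small by (intro ennreal_add_le_cancel) auto
  then show ?thesis using dim_Diff_singleton[OF dset_diff_quot] by simp
qed

end

section \<open>From the type-definable set to definable approximations\<close>

lemma type_dim_le:
  assumes "dset L M Z" "X \<subseteq> Z"
  shows "type_dim L M \<delta> 1 (singles X) \<le> \<delta> (singles Z)"
proof -
  obtain \<phi> where \<phi>: "\<phi> \<in> formulas L UNIV 1" "singles Z = solutions M 1 \<phi>"
    using assms(1) unfolding dset_def definable_def definable_over_def by blast
  have "singles X \<subseteq> solutions M 1 \<phi>"
    using assms(2) unfolding \<phi>(2)[symmetric] by (simp add: singles_subset_iff)
  then show ?thesis unfolding type_dim_def \<phi>(2) using \<phi>(1) by (intro INF_lower) simp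
qed

lemma dset_if_type_dim_less:
  assumes "type_dim L M \<delta> 1 (singles X) < r"
  obtains Z where "dset L M Z" "X \<subseteq> Z" "\<delta> (singles Z) < r"
proof -
  obtain \<phi> where \<phi>: "\<phi> \<in> formulas L UNIV 1" "singles X \<subseteq> solutions M 1 \<phi>" "\<delta> (solutions M 1 \<phi>) < r"
    using assms unfolding type_dim_def INF_less_iff by blast
  define Z where "Z = {x. [x] \<in> solutions M 1 \<phi>}"
  have Z: "singles Z = solutions M 1 \<phi>"
    unfolding Z_def singles_conv solutions_def by (auto simp: length_Suc_conv)
  then have "dset L M Z" using \<phi>(1) unfolding dset_def definable_def definable_over_def by blast
  then show ?thesis using that[of Z] \<phi>(2,3) unfolding Z[symmetric] singles_subset_iff by blast
qed

text \<open>A definable superset \<open>X\<close> of YY - Y has dimension below d + e, and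
  compactness turns this into a definable \<open>B\<close> with BB - B inside \<open>X\<close>. A
  second use of compactness, for the equation y0 - y1 = a(y2 - y3), gives
  \<open>separation\<close>.\<close>

lemma ex_approx_popular:
  fixes F :: "('a::field, 'f, 'r) fo_structure"
  assumes "expands_field L F" and sat: "sufficiently_saturated \<kappa> L F"
    and "continuous_dimension L F \<delta>" and A: "|A| <o \<kappa>"
    and Y: "type_definable L F A 1 (singles Y)"
    and dimY: "type_dim L F \<delta> 1 (singles Y) = ennreal d"
    and dimYY: "type_dim L F \<delta> 1 (singles (set_diff (set_mult Y Y) Y)) = ennreal d"
    and e: "0 < e" "200 * e \<le> d"
  shows "\<exists>B S. approx_popular L F \<delta> Y B d e S"
proof -
  interpret dim_field L F \<delta>
    using assms(1,3) by (simp add: dim_field_def dim_field_axioms_def)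
  have "type_dim L F \<delta> 1 (singles (set_diff (set_mult Y Y) Y)) < ennreal (d + e)"
    using dimYY e by (simp add: ennreal_less_iff del: ennreal_plus)
  then obtain X where X: "dset L F X" "set_diff (set_mult Y Y) Y \<subseteq> X" "dim X < ennreal (d + e)"
    by (rule dset_if_type_dim_less)
  obtain B where B: "dset L F B" "Y \<subseteq> B"
    "\<And>b0 b1 b2 b3. b0 \<in> B \<Longrightarrow> b1 \<in> B \<Longrightarrow> b2 \<in> B \<Longrightarrow> b3 \<in> B \<Longrightarrow> b0 * b1 - b2 \<in> X"
  proof (rule compactness_quadruples[OF sat A Y, of "\<lambda>y0 y1 y2 y3. y0 * y1 - y2 \<in> X"])
    show "dfn L F (\<lambda>v. v 0 * v 1 - v 2 \<in> X)" by (intro dfn_field_intros X)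
    show "y0 * y1 - y2 \<in> X" if "y0 \<in> Y" "y1 \<in> Y" "y2 \<in> Y" for y0 y1 y2
      using that X(2) unfolding set_diff_def set_mult_def by blast
  qed (rule that)
  interpret approx L F \<delta> Y B d e
  proof
    show "ennreal d \<le> dim Z" if "dset L F Z" "Y \<subseteq> Z" for Z
      using type_dim_le[OF that, of \<delta>] dimY by simp
    show "dim (lin c B (- 1) B) \<le> ennreal (d + e)" if "c \<in> B" for c
    proof -
      have "lin c B (- 1) B \<subseteq> X" using B(3)[OF that] by (auto elim!: linE)
      then have "dim (lin c B (- 1) B) \<le> dim X" by (intro dim_mono dset_lin B X)
      then show ?thesis using X(3) by simp
    qed
    fix a assume a: "a \<notin> diff_quot Y"
    obtain Z where "dset L F Z" "Y \<subseteq> Z"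
      "\<And>z0 z1 z2 z3. z0 \<in> Z \<Longrightarrow> z1 \<in> Z \<Longrightarrow> z2 \<in> Z \<Longrightarrow> z3 \<in> Z \<Longrightarrow> z2 = z3 \<or> \<not> z0 - z1 = a * (z2 - z3)"
    proof (rule compactness_quadruples[OF sat A Y, of "\<lambda>y0 y1 y2 y3. y2 = y3 \<or> \<not> y0 - y1 = a * (y2 - y3)"])
      show "dfn L F (\<lambda>v. v 2 = v 3 \<or> \<not> v 0 - v 1 = a * (v 2 - v 3))" by (intro dfn_field_intros)
      show "y2 = y3 \<or> \<not> y0 - y1 = a * (y2 - y3)"
        if "y0 \<in> Y" "y1 \<in> Y" "y2 \<in> Y" "y3 \<in> Y" for y0 y1 y2 y3
        using diff_quotI[OF that] a by auto
    qed (rule that)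
    then show "\<exists>Z. dset L F Z \<and> Y \<subseteq> Z \<and>
      (\<forall>z0\<in>Z. \<forall>z1\<in>Z. \<forall>z2\<in>Z. \<forall>z3\<in>Z. z2 \<noteq> z3 \<longrightarrow> z0 - z1 \<noteq> a * (z2 - z3))"
      by blast
  qed (use B e in auto)
  obtain S where "dset L F S" "0 \<in> S" "\<forall>x\<in>S. - x \<in> S"
    "\<forall>x\<in>S. ennreal (d - 4 * e) \<le> dim (shift_inter x)"
    "\<forall>x. x \<notin> S \<longrightarrow> dim (shift_inter x) \<le> ennreal (d - 3 * e)"
    using ex_popular_differences by blast
  then have "approx_popular L F \<delta> Y B d e S" by unfold_locales auto
  then show ?thesis by blast
qed

theorem theorem6p1:
  fixes L :: "('f, 'r) language"
    and F :: "('a::field, 'f, 'r) fo_structure"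
    and \<kappa> :: "'k rel"
    and \<delta> :: "'a list set \<Rightarrow> ennreal"
    and A Y :: "'a set"
  assumes "expands_field L F"
    and "sufficiently_saturated \<kappa> L F"
    and "continuous_dimension L F \<delta>"
    and "|A| <o \<kappa>"
    and "type_definable L F A 1 (singles Y)"
    and "0 < type_dim L F \<delta> 1 (singles (set_diff (set_mult Y Y) Y))"
    and "type_dim L F \<delta> 1 (singles (set_diff (set_mult Y Y) Y)) = type_dim L F \<delta> 1 (singles Y)"
    and "type_dim L F \<delta> 1 (singles Y) < \<infinity>"
  shows "is_subfield (set_quot (set_diff Y Y) (set_diff Y Y)) \<and>
    definable L F 1 (singles (set_quot (set_diff Y Y) (set_diff Y Y))) \<and>
    \<delta> (singles (set_quot (set_diff Y Y) (set_diff Y Y))) = type_dim L F \<delta> 1 (singles Y)"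
proof -
  obtain d where d: "type_dim L F \<delta> 1 (singles Y) = ennreal d" "0 < d"
    using assms(6-8) by (cases "type_dim L F \<delta> 1 (singles Y)") auto
  have approx: "\<exists>B S. approx_popular L F \<delta> Y B d e S" if "0 < e" "200 * e \<le> d" for e
    using assms(7) d(1) that by (intro ex_approx_popular[OF assms(1-5)]) simp_all
  \<comment> \<open>Any admissible error gives the field property and definability; the largest one
    is taken.\<close>
  from approx[of "d / 200"] d(2) obtain B S where "approx_popular L F \<delta> Y B d (d / 200) S" by auto
  then interpret approx_popular L F \<delta> Y B d "d / 200" S .
  \<comment> \<open>The field does not depend on the approximation, so the error e in the bound d +
    134e may be taken arbitrarily small.\<close>
  have "dim (diff_quot Y) \<le> ennreal d"
  proof (rule ennreal_le_epsilon)
    fix \<epsilon> :: real assume "0 < \<epsilon>"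
    define e where "e = min (d / 200) (\<epsilon> / 134)"
    have e: "0 < e" "200 * e \<le> d" "134 * e \<le> \<epsilon>"
      using d(2) \<open>0 < \<epsilon>\<close> unfolding e_def by (auto simp: min_def)
    obtain B' S' where "approx_popular L F \<delta> Y B' d e S'" using approx[OF e(1,2)] by blast
    then have "dim (diff_quot Y) \<le> ennreal (d + 134 * e)" by (rule approx_popular.dim_diff_quot_le)
    also have "\<dots> \<le> ennreal (d + \<epsilon>)" using e(3) by (intro ennreal_leI) simp
    also have "\<dots> = ennreal d + ennreal \<epsilon>" using d(2) \<open>0 < \<epsilon>\<close> by simp
    finally show "dim (diff_quot Y) \<le> ennreal d + ennreal \<epsilon>" .
  qed
  then have "dim (diff_quot Y) = type_dim L F \<delta> 1 (singles Y)"
    using d_le_dim_diff_quot d(1) by simp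
  then show ?thesis using diff_quot_subfield dset_diff_quot unfolding dset_def by simp
qed

end
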